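(* Let $L\dashv R:\mathcal{C}\to\mathcal{X}$, $\widetilde{L}\dashv\widetilde{R}:\mathcal{P}\to\mathcal{Q}$, $\overline{L}\dashv\overline{R}:\mathcal{D}\to\mathcal{Y}$ be adjunctions, let $$(J,V,\lambda^{JV}):L\times\widetilde{L}\dashv R\times\widetilde{R}\to\overline{L}\dashv\overline{R}$$ be a left Hopf 1-cell in $\mathbf{Adj}_R(\mathbf{Cat})$, and let $J\dashv_{\mathcal{P}}K$ and $V\dashv_{\mathcal{Q}}W$ be parametric adjunctions. Then (i) $(J(\mathcal{C}\times\widetilde{R}),V,\lambda^{JV\widetilde{R}}):L\times\mathcal{Q}\dashv R\times\mathcal{Q}\to\overline{L}\dashv\overline{R}$ and (ii) $(K(\widetilde{R}^{op}\times\mathcal{D}),W,\lambda^{KW\widetilde{R}}):\mathcal{Q}^{op}\times\overline{L}\dashv\mathcal{Q}^{op}\times\overline{R}\to L\dashv R$ are 1-cells in $\mathbf{Adj}_R(\mathbf{Cat})$, and for each $Q$ in $\mathcal{Q}$ there is an adjoint object in $\mathbf{Adj}_R(\mathbf{Cat})$ $$(J_{\widetilde{R}Q},V_Q,\lambda^{JV\widetilde{R}Q})\dashv(K_{\widetilde{R}Q},W_Q,\lambda^{KW\widetilde{R}Q}).$$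
   Context: All categories are small. A category name also denotes its identity functor; juxtaposition denotes composition and whiskering. $L\dashv R:\mathcal{C}\to\mathcal{X}$ means $L:\mathcal{C}\to\mathcal{X}$ is left adjoint to $R$, with unit $\eta^{RL}$ and counit $\varepsilon^{LR}$. $\mathbf{Adj}_R(\mathbf{Cat})$: 0-cells are adjunctions; a 1-cell $(J,V,\lambda^{JV}):(L\dashv R:\mathcal{C}\to\mathcal{X})\to(\overline{L}\dashv\overline{R}:\mathcal{D}\to\mathcal{Y})$ consists of functors $J:\mathcal{C}\to\mathcal{D}$, $V:\mathcal{X}\to\mathcal{Y}$ and $\lambda^{JV}:\overline{L}J\to VL$ whose mate $\rho^{JV}=\overline{R}V\varepsilon^{LR}\circ\overline{R}\lambda^{JV}R\circ\eta^{\overline{R}\,\overline{L}}JR:JR\to\overline{R}V$ is invertible; a 2-cell $(J,V,\lambda)\to(J',V',\lambda')$ is a pair $(\alpha:J\to J',\beta:V\to V')$ with $\beta L\circ\lambda=\lambda'\circ\overline{L}\alpha$. The composite $(K,W,\lambda^{KW})(J,V,\lambda^{JV})$ has left mate $W\lambda^{JV}\circ\lambda^{KW}J$. An adjoint object $(J,V,\lambda^{JV})\dashv(K,W,\lambda^{KW})$ is given by adjunctions $J\dashv K$, $V\dashv W$ such that the pair of units and the pair of counits are 2-cells. Parametric adjunction $J\dashv_{\mathcal{P}}K$: functors $J:\mathcal{C}\times\mathcal{P}\to\mathcal{D}$, $K:\mathcal{P}^{op}\times\mathcal{D}\to\mathcal{C}$ with, for each $P$, an adjunction $J_P=J(-,P)\dashv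 K_P=K(P,-)$ with unit $\eta^P$, counit $\varepsilon^P$, such that for $p:P\to P'$, $K_{p^{op}}=K_P\varepsilon^{P'}\circ K_PJ_pK_{P'}\circ\eta^PK_{P'}$. Here $J:\mathcal{C}\times\mathcal{P}\to\mathcal{D}$, $V:\mathcal{X}\times\mathcal{Q}\to\mathcal{Y}$. For $(J,V,\lambda^{JV}):L\times\widetilde{L}\dashv R\times\widetilde{R}\to\overline{L}\dashv\overline{R}$, set $H(\lambda^{JV})=V(L\times\varepsilon^{\widetilde{L}\widetilde{R}})\circ\lambda^{JV}(\mathcal{C}\times\widetilde{R}):\overline{L}J(\mathcal{C}\times\widetilde{R})\to V(L\times\mathcal{Q})$. The 1-cell is left Hopf if $H(\lambda^{JV})$ is invertible. Write $\lambda^{JV\widetilde{R}}=H(\lambda^{JV})$ and, for $Q$ in $\mathcal{Q}$, $\lambda^{JV\widetilde{R}Q}=H(\lambda^{JV})_{(-,Q)}:\overline{L}J_{\widetilde{R}Q}\to V_QL$. Put $$\lambda^{KW\widetilde{R}Q}=W_Q\overline{L}\varepsilon\circ W_Q(\lambda^{JV\widetilde{R}Q})^{-1}K_{\widetilde{R}Q}\circ\eta LK_{\widetilde{R}Q}:LK_{\widetilde{R}Q}\to W_Q\overline{L},$$ where $\varepsilon$ is the counit of $J_{\widetilde{R}Q}\dashv K_{\widetilde{R}Q}$ and $\eta$ the unit of $V_Q\dashv W_Q$; $\lambda^{KW\widetilde{R}}:LK(\widetilde{R}^{op}\times\mathcal{D})\to W(\mathcal{Q}^{op}\times\overline{L})$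 is the transformation with components $\lambda^{KW\widetilde{R}}(Q,D)=\lambda^{KW\widetilde{R}Q}_D$. (The paper calls the resulting structure a Hopf parametric adjoint object in $\mathbf{Adj}_R(\mathbf{Cat})$.) *)

theory Defs
  imports Main
begin

record ('o, 'm) cat =
  Ob  :: "'o set"
  Ar  :: "'m set"
  Dom :: "'m \<Rightarrow> 'o"
  Cod :: "'m \<Rightarrow> 'o"
  Idn :: "'o \<Rightarrow> 'm"
  Cmp :: "'m \<Rightarrow> 'm \<Rightarrow> 'm"  (infixr "\<cdot>\<index>" 70)

definition Hom :: "('o, 'm) cat \<Rightarrow> 'o \<Rightarrow> 'o \<Rightarrow> 'm set"
  where "Hom C x y = {f \<in> Ar C. Dom C f = x \<and> Cod C f = y}"

locale category =
  fixes C :: "('o, 'm) cat" (structure)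
  assumes Dom_in_Ob: "f \<in> Ar C \<Longrightarrow> Dom C f \<in> Ob C"
    and Cod_in_Ob: "f \<in> Ar C \<Longrightarrow> Cod C f \<in> Ob C"
    and Idn_in_Hom: "x \<in> Ob C \<Longrightarrow> Idn C x \<in> Hom C x x"
    and Cmp_in_Hom: "\<lbrakk>f \<in> Hom C x y; g \<in> Hom C y z\<rbrakk> \<Longrightarrow> g \<cdot> f \<in> Hom C x z"
    and Cmp_Idn: "f \<in> Hom C x y \<Longrightarrow> f \<cdot> Idn C x = f"
    and Idn_Cmp: "f \<in> Hom C x y \<Longrightarrow> Idn C y \<cdot> f = f"
    and Cmp_assoc:
      "\<lbrakk>f \<in> Hom C w x; g \<in> Hom C x y; h \<in> Hom C y z\<rbrakk> \<Longrightarrow> (h \<cdot> g) \<cdot> f = h \<cdot> (g \<cdot> f)"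

text \<open>A functor is given by its action on objects and arrows only. Source and target are
  arguments of the predicate below, and values outside the source category are irrelevant.\<close>

record ('o1, 'm1, 'o2, 'm2) func =
  FOb :: "'o1 \<Rightarrow> 'o2"
  FAr :: "'m1 \<Rightarrow> 'm2"

locale cat_functor =
  source: category C + target: category D
  for C :: "('o1, 'm1) cat" and D :: "('o2, 'm2) cat" +
  fixes F :: "('o1, 'm1, 'o2, 'm2) func"
  assumes FOb_in_Ob: "x \<in> Ob C \<Longrightarrow> FOb F x \<in> Ob D"
    and FAr_in_Hom: "f \<in> Hom C x y \<Longrightarrow> FAr F f \<in> Hom D (FOb F x) (FOb F y)"
    and FAr_Idn: "x \<in> Ob C \<Longrightarrow> FAr F (Idn C x) = Idn D (FOb F x)"
    and FAr_Cmp: "\<lbrakk>f \<in> Hom C x y; g \<in> Hom C y z\<rbrakk>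
      \<Longrightarrow> FAr F (g \<cdot>\<^bsub>C\<^esub> f) = FAr F g \<cdot>\<^bsub>D\<^esub> FAr F f"

locale nat_trans =
  F: cat_functor C D F + G: cat_functor C D G
  for C :: "('o1, 'm1) cat" and D :: "('o2, 'm2) cat" and F G +
  fixes \<tau> :: "'o1 \<Rightarrow> 'm2"
  assumes component_in_Hom: "x \<in> Ob C \<Longrightarrow> \<tau> x \<in> Hom D (FOb F x) (FOb G x)"
    and naturality: "f \<in> Hom C x y \<Longrightarrow> \<tau> y \<cdot>\<^bsub>D\<^esub> FAr F f = FAr G f \<cdot>\<^bsub>D\<^esub> \<tau> x"

definition inverse_arrows :: "('o, 'm) cat \<Rightarrow> 'm \<Rightarrow> 'm \<Rightarrow> bool"
  where "inverse_arrows C f g \<longleftrightarrow>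
    f \<in> Ar C \<and> g \<in> Hom C (Cod C f) (Dom C f) \<and>
    g \<cdot>\<^bsub>C\<^esub> f = Idn C (Dom C f) \<and> f \<cdot>\<^bsub>C\<^esub> g = Idn C (Cod C f)"

definition inv_arrow :: "('o, 'm) cat \<Rightarrow> 'm \<Rightarrow> 'm"
  where "inv_arrow C f = (THE g. inverse_arrows C f g)"

definition invertible_trans ::
  "('o1, 'm1) cat \<Rightarrow> ('o2, 'm2) cat \<Rightarrow> ('o1, 'm1, 'o2, 'm2) func \<Rightarrow>
   ('o1, 'm1, 'o2, 'm2) func \<Rightarrow> ('o1 \<Rightarrow> 'm2) \<Rightarrow> bool"
  where "invertible_trans C D F G \<tau> \<longleftrightarrow>
    nat_trans C D F G \<tau> \<and>
    (\<exists>\<sigma>. nat_trans C D G F \<sigma> \<and> (\<forall>x\<in>Ob C. inverse_arrows D (\<tau> x) (\<sigma> x)))"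

definition id_func :: "('o, 'm, 'o, 'm) func"
  where "id_func = \<lparr>FOb = \<lambda>x. x, FAr = \<lambda>f. f\<rparr>"

definition comp_func ::
  "('o2, 'm2, 'o3, 'm3) func \<Rightarrow> ('o1, 'm1, 'o2, 'm2) func \<Rightarrow> ('o1, 'm1, 'o3, 'm3) func"
  (infixr "\<circ>\<^sub>f" 75)
  where "G \<circ>\<^sub>f F = \<lparr>FOb = \<lambda>x. FOb G (FOb F x), FAr = \<lambda>f. FAr G (FAr F f)\<rparr>"

definition id_trans :: "('o2, 'm2) cat \<Rightarrow> ('o1, 'm1, 'o2, 'm2) func \<Rightarrow> 'o1 \<Rightarrow> 'm2"
  where "id_trans D F = (\<lambda>x. Idn D (FOb F x))"

definition vcomp :: "('o2, 'm2) cat \<Rightarrow> ('o1 \<Rightarrow> 'm2) \<Rightarrow> ('o1 \<Rightarrow> 'm2) \<Rightarrow> 'o1 \<Rightarrow> 'm2"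
  (infixr "\<bullet>\<index>" 65)
  where "\<tau> \<bullet>\<^bsub>D\<^esub> \<sigma> = (\<lambda>x. \<tau> x \<cdot>\<^bsub>D\<^esub> \<sigma> x)"

definition whisker_left :: "('o2, 'm2, 'o3, 'm3) func \<Rightarrow> ('o1 \<Rightarrow> 'm2) \<Rightarrow> 'o1 \<Rightarrow> 'm3"
  (infixr "\<triangleright>" 73)
  where "G \<triangleright> \<tau> = (\<lambda>x. FAr G (\<tau> x))"

definition whisker_right :: "('o2 \<Rightarrow> 'm3) \<Rightarrow> ('o1, 'm1, 'o2, 'm2) func \<Rightarrow> 'o1 \<Rightarrow> 'm3"
  (infixl "\<triangleleft>" 80)
  where "\<tau> \<triangleleft> F = (\<lambda>x. \<tau> (FOb F x))"

definition inv_trans :: "('o2, 'm2) cat \<Rightarrow> ('o1 \<Rightarrow> 'm2) \<Rightarrow> 'o1 \<Rightarrow> 'm2"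
  where "inv_trans D \<tau> = (\<lambda>x. inv_arrow D (\<tau> x))"

definition prod_cat :: "('o1, 'm1) cat \<Rightarrow> ('o2, 'm2) cat \<Rightarrow> ('o1 \<times> 'o2, 'm1 \<times> 'm2) cat"
  (infixr "\<times>\<^sub>c" 80)
  where "C \<times>\<^sub>c D =
    \<lparr>Ob = Ob C \<times> Ob D, Ar = Ar C \<times> Ar D,
     Dom = map_prod (Dom C) (Dom D), Cod = map_prod (Cod C) (Cod D),
     Idn = map_prod (Idn C) (Idn D),
     Cmp = (\<lambda>(g, g') (f, f'). (g \<cdot>\<^bsub>C\<^esub> f, g' \<cdot>\<^bsub>D\<^esub> f'))\<rparr>"

definition prod_func ::
  "('o1, 'm1, 'o2, 'm2) func \<Rightarrow> ('o3, 'm3, 'o4, 'm4) func \<Rightarrow>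
   ('o1 \<times> 'o3, 'm1 \<times> 'm3, 'o2 \<times> 'o4, 'm2 \<times> 'm4) func"
  (infixr "\<times>\<^sub>f" 80)
  where "F \<times>\<^sub>f G = \<lparr>FOb = map_prod (FOb F) (FOb G), FAr = map_prod (FAr F) (FAr G)\<rparr>"

definition prod_trans :: "('o1 \<Rightarrow> 'm2) \<Rightarrow> ('o3 \<Rightarrow> 'm4) \<Rightarrow> 'o1 \<times> 'o3 \<Rightarrow> 'm2 \<times> 'm4"
  (infixr "\<times>\<^sub>t" 80)
  where "\<sigma> \<times>\<^sub>t \<tau> = map_prod \<sigma> \<tau>"

definition op_cat :: "('o, 'm) cat \<Rightarrow> ('o, 'm) cat"
  where "op_cat C =
    \<lparr>Ob = Ob C, Ar = Ar C, Dom = Cod C, Cod = Dom C, Idn = Idn C, Cmp = (\<lambda>g f. f \<cdot>\<^bsub>C\<^esub> g)\<rparr>"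

text \<open>An arrow and its opposite are the same element, so a functor and its opposite have the
  same underlying maps; they differ only in the categories they are regarded between.\<close>

definition op_func :: "('o1, 'm1, 'o2, 'm2) func \<Rightarrow> ('o1, 'm1, 'o2, 'm2) func"
  where "op_func F = F"

text \<open>\<open>fix_snd P J p\<close> is the functor \<open>J(-,p)\<close>, where \<open>P\<close> is the category of the second argument;
  \<open>arr_snd C J f\<close> is the transformation \<open>J(-,Dom f) \<rightarrow> J(-,Cod f)\<close> induced by an arrow \<open>f\<close>,
  where \<open>C\<close> is the category of the first argument. Similarly for \<open>fix_fst\<close> and
  \<open>arr_fst\<close>; for \<open>K\<close> contravariant in its first argument, \<open>arr_fst D K f\<close> goes from \<open>K(Cod f,-)\<close> to
  \<open>K(Dom f,-)\<close>, with \<open>Dom\<close> and \<open>Cod\<close> taken before passing to the opposite category.\<close>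

definition fix_snd ::
  "('p, 'pm) cat \<Rightarrow> ('c \<times> 'p, 'cm \<times> 'pm, 'd, 'dm) func \<Rightarrow> 'p \<Rightarrow> ('c, 'cm, 'd, 'dm) func"
  where "fix_snd P J p = \<lparr>FOb = \<lambda>c. FOb J (c, p), FAr = \<lambda>f. FAr J (f, Idn P p)\<rparr>"

definition arr_snd ::
  "('c, 'cm) cat \<Rightarrow> ('c \<times> 'p, 'cm \<times> 'pm, 'd, 'dm) func \<Rightarrow> 'pm \<Rightarrow> 'c \<Rightarrow> 'dm"
  where "arr_snd C J f = (\<lambda>c. FAr J (Idn C c, f))"

definition fix_fst ::
  "('p, 'pm) cat \<Rightarrow> ('p \<times> 'd, 'pm \<times> 'dm, 'c, 'cm) func \<Rightarrow> 'p \<Rightarrow> ('d, 'dm, 'c, 'cm) func"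
  where "fix_fst P K p = \<lparr>FOb = \<lambda>d. FOb K (p, d), FAr = \<lambda>g. FAr K (Idn P p, g)\<rparr>"

definition arr_fst ::
  "('d, 'dm) cat \<Rightarrow> ('p \<times> 'd, 'pm \<times> 'dm, 'c, 'cm) func \<Rightarrow> 'pm \<Rightarrow> 'd \<Rightarrow> 'cm"
  where "arr_fst D K f = (\<lambda>d. FAr K (f, Idn D d))"

text \<open>The left adjoint goes from \<open>lcat\<close> to \<open>rcat\<close>.\<close>

record ('c, 'cm, 'x, 'xm) adj =
  lcat :: "('c, 'cm) cat"
  rcat :: "('x, 'xm) cat"
  ladj :: "('c, 'cm, 'x, 'xm) func"
  radj :: "('x, 'xm, 'c, 'cm) func"
  unit :: "'c \<Rightarrow> 'cm"
  counit :: "'x \<Rightarrow> 'xm"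

locale adjunction =
  fixes A :: "('c, 'cm, 'x, 'xm) adj"
  assumes ladj_functor: "cat_functor (lcat A) (rcat A) (ladj A)"
    and radj_functor: "cat_functor (rcat A) (lcat A) (radj A)"
    and unit_trans: "nat_trans (lcat A) (lcat A) id_func (radj A \<circ>\<^sub>f ladj A) (unit A)"
    and counit_trans: "nat_trans (rcat A) (rcat A) (ladj A \<circ>\<^sub>f radj A) id_func (counit A)"
    and triangle_left: "c \<in> Ob (lcat A) \<Longrightarrow>
      (counit A \<triangleleft> ladj A \<bullet>\<^bsub>rcat A\<^esub> ladj A \<triangleright> unit A) c = id_trans (rcat A) (ladj A) c"
    and triangle_right: "x \<in> Ob (rcat A) \<Longrightarrow>
      (radj A \<triangleright> counit A \<bullet>\<^bsub>lcat A\<^esub> unit A \<triangleleft> radj A) x = id_trans (lcat A) (radj A) x"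

definition id_adj :: "('c, 'cm) cat \<Rightarrow> ('c, 'cm, 'c, 'cm) adj"
  where "id_adj C =
    \<lparr>lcat = C, rcat = C, ladj = id_func, radj = id_func, unit = Idn C, counit = Idn C\<rparr>"

definition prod_adj ::
  "('c, 'cm, 'x, 'xm) adj \<Rightarrow> ('p, 'pm, 'q, 'qm) adj \<Rightarrow>
   ('c \<times> 'p, 'cm \<times> 'pm, 'x \<times> 'q, 'xm \<times> 'qm) adj"
  (infixr "\<times>\<^sub>a" 80)
  where "A \<times>\<^sub>a B =
    \<lparr>lcat = lcat A \<times>\<^sub>c lcat B, rcat = rcat A \<times>\<^sub>c rcat B,
     ladj = ladj A \<times>\<^sub>f ladj B, radj = radj A \<times>\<^sub>f radj B,
     unit = unit A \<times>\<^sub>t unit B, counit = counit A \<times>\<^sub>t counit B\<rparr>"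

text \<open>The adjunction \<open>J(-,p) \<stileturn> K(p,-)\<close> with unit \<open>\<eta> p\<close> and counit \<open>\<epsilon> p\<close>.\<close>

definition param_adj_at ::
  "('c, 'cm) cat \<Rightarrow> ('p, 'pm) cat \<Rightarrow> ('d, 'dm) cat \<Rightarrow>
   ('c \<times> 'p, 'cm \<times> 'pm, 'd, 'dm) func \<Rightarrow> ('p \<times> 'd, 'pm \<times> 'dm, 'c, 'cm) func \<Rightarrow>
   ('p \<Rightarrow> 'c \<Rightarrow> 'cm) \<Rightarrow> ('p \<Rightarrow> 'd \<Rightarrow> 'dm) \<Rightarrow> 'p \<Rightarrow> ('c, 'cm, 'd, 'dm) adj"
  where "param_adj_at C P D J K \<eta> \<epsilon> p =
    \<lparr>lcat = C, rcat = D, ladj = fix_snd P J p, radj = fix_fst P K p, unit = \<eta> p, counit = \<epsilon> p\<rparr>"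

locale parametric_adjunction =
  fixes C :: "('c, 'cm) cat" and P :: "('p, 'pm) cat" and D :: "('d, 'dm) cat"
    and J :: "('c \<times> 'p, 'cm \<times> 'pm, 'd, 'dm) func"
    and K :: "('p \<times> 'd, 'pm \<times> 'dm, 'c, 'cm) func"
    and \<eta> :: "'p \<Rightarrow> 'c \<Rightarrow> 'cm" and \<epsilon> :: "'p \<Rightarrow> 'd \<Rightarrow> 'dm"
  assumes categories: "category C" "category P" "category D"
    and left_functor: "cat_functor (C \<times>\<^sub>c P) D J"
    and right_functor: "cat_functor (op_cat P \<times>\<^sub>c D) C K"
    and adjunction_at: "p \<in> Ob P \<Longrightarrow> adjunction (param_adj_at C P D J K \<eta> \<epsilon> p)"
    and right_on_arrows: "\<lbrakk>f \<in> Hom P p p'; d \<in> Ob D\<rbrakk> \<Longrightarrow>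
      arr_fst D K f d =
        (fix_fst P K p \<triangleright> \<epsilon> p' \<bullet>\<^bsub>C\<^esub>
         fix_fst P K p \<triangleright> arr_snd C J f \<triangleleft> fix_fst P K p' \<bullet>\<^bsub>C\<^esub>
         \<eta> p \<triangleleft> fix_fst P K p') d"

text \<open>A 1-cell \<open>(J, V, lam)\<close> carries its left mate \<open>lam\<close>, a transformation from the left adjoint of
  the target after \<open>J\<close> to \<open>V\<close> after the left adjoint of the source.\<close>

type_synonym ('c, 'cm, 'x, 'xm, 'd, 'dm, 'y, 'ym) cell =
  "('c, 'cm, 'd, 'dm) func \<times> ('x, 'xm, 'y, 'ym) func \<times> ('c \<Rightarrow> 'ym)"

fun right_mate ::
  "('c, 'cm, 'x, 'xm) adj \<Rightarrow> ('d, 'dm, 'y, 'ym) adj \<Rightarrow>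
   ('c, 'cm, 'x, 'xm, 'd, 'dm, 'y, 'ym) cell \<Rightarrow> 'x \<Rightarrow> 'dm"
  where "right_mate A B (J, V, lam) =
    (radj B \<circ>\<^sub>f V \<triangleright> counit A \<bullet>\<^bsub>lcat B\<^esub>
     radj B \<triangleright> lam \<triangleleft> radj A \<bullet>\<^bsub>lcat B\<^esub>
     unit B \<triangleleft> (J \<circ>\<^sub>f radj A))"

fun one_cell ::
  "('c, 'cm, 'x, 'xm) adj \<Rightarrow> ('d, 'dm, 'y, 'ym) adj \<Rightarrow>
   ('c, 'cm, 'x, 'xm, 'd, 'dm, 'y, 'ym) cell \<Rightarrow> bool"
  where "one_cell A B (J, V, lam) \<longleftrightarrow>
    adjunction A \<and> adjunction B \<and>
    cat_functor (lcat A) (lcat B) J \<and>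
    cat_functor (rcat A) (rcat B) V \<and>
    nat_trans (lcat A) (rcat B) (ladj B \<circ>\<^sub>f J) (V \<circ>\<^sub>f ladj A) lam \<and>
    invertible_trans (rcat A) (lcat B) (J \<circ>\<^sub>f radj A) (radj B \<circ>\<^sub>f V)
      (right_mate A B (J, V, lam))"

definition id_cell :: "('c, 'cm, 'x, 'xm) adj \<Rightarrow> ('c, 'cm, 'x, 'xm, 'c, 'cm, 'x, 'xm) cell"
  where "id_cell A = (id_func, id_func, id_trans (rcat A) (ladj A))"

text \<open>\<open>comp_cell B'' N M\<close> is \<open>N\<close> after \<open>M\<close>, where \<open>B''\<close> is the target of \<open>N\<close>.\<close>

fun comp_cell ::
  "('e, 'em, 'z, 'zm) adj \<Rightarrow> ('d, 'dm, 'y, 'ym, 'e, 'em, 'z, 'zm) cell \<Rightarrow>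
   ('c, 'cm, 'x, 'xm, 'd, 'dm, 'y, 'ym) cell \<Rightarrow> ('c, 'cm, 'x, 'xm, 'e, 'em, 'z, 'zm) cell"
  where "comp_cell B'' (K, W, kap) (J, V, lam) =
    (K \<circ>\<^sub>f J, W \<circ>\<^sub>f V, W \<triangleright> lam \<bullet>\<^bsub>rcat B''\<^esub> kap \<triangleleft> J)"

fun two_cell ::
  "('c, 'cm, 'x, 'xm) adj \<Rightarrow> ('d, 'dm, 'y, 'ym) adj \<Rightarrow>
   ('c, 'cm, 'x, 'xm, 'd, 'dm, 'y, 'ym) cell \<Rightarrow> ('c, 'cm, 'x, 'xm, 'd, 'dm, 'y, 'ym) cell \<Rightarrow>
   ('c \<Rightarrow> 'dm) \<times> ('x \<Rightarrow> 'ym) \<Rightarrow> bool"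
  where "two_cell A B (J, V, lam) (J', V', lam') (\<alpha>, \<beta>) \<longleftrightarrow>
    one_cell A B (J, V, lam) \<and> one_cell A B (J', V', lam') \<and>
    nat_trans (lcat A) (lcat B) J J' \<alpha> \<and>
    nat_trans (rcat A) (rcat B) V V' \<beta> \<and>
    (\<forall>c\<in>Ob (lcat A).
      (\<beta> \<triangleleft> ladj A \<bullet>\<^bsub>rcat B\<^esub> lam) c = (lam' \<bullet>\<^bsub>rcat B\<^esub> ladj B \<triangleright> \<alpha>) c)"

text \<open>The last two arguments are the pair of units and the pair of counits of the adjunctions
  \<open>J \<stileturn> K\<close> and \<open>V \<stileturn> W\<close>.\<close>

fun adjoint_object ::
  "('c, 'cm, 'x, 'xm) adj \<Rightarrow> ('d, 'dm, 'y, 'ym) adj \<Rightarrow>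
   ('c, 'cm, 'x, 'xm, 'd, 'dm, 'y, 'ym) cell \<Rightarrow> ('d, 'dm, 'y, 'ym, 'c, 'cm, 'x, 'xm) cell \<Rightarrow>
   ('c \<Rightarrow> 'cm) \<times> ('x \<Rightarrow> 'xm) \<Rightarrow> ('d \<Rightarrow> 'dm) \<times> ('y \<Rightarrow> 'ym) \<Rightarrow> bool"
  where "adjoint_object A B (J, V, lam) (K, W, kap) (\<eta>JK, \<eta>VW) (\<epsilon>JK, \<epsilon>VW) \<longleftrightarrow>
    one_cell A B (J, V, lam) \<and> one_cell B A (K, W, kap) \<and>
    adjunction
      \<lparr>lcat = lcat A, rcat = lcat B, ladj = J, radj = K, unit = \<eta>JK, counit = \<epsilon>JK\<rparr> \<and>
    adjunction
      \<lparr>lcat = rcat A, rcat = rcat B, ladj = V, radj = W, unit = \<eta>VW, counit = \<epsilon>VW\<rparr> \<and>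
    two_cell A A (id_cell A) (comp_cell A (K, W, kap) (J, V, lam)) (\<eta>JK, \<eta>VW) \<and>
    two_cell B B (comp_cell B (J, V, lam) (K, W, kap)) (id_cell B) (\<epsilon>JK, \<epsilon>VW)"

text \<open>For a 1-cell from \<open>A \<times>\<^sub>a A'\<close> to \<open>B\<close>, the component at \<open>(c, q)\<close> is \<open>V(id, counit\<^sub>q) \<cdot> lam(c, radj q)\<close>.\<close>

definition hopf_trans ::
  "('c, 'cm, 'x, 'xm) adj \<Rightarrow> ('p, 'pm, 'q, 'qm) adj \<Rightarrow> ('d, 'dm, 'y, 'ym) adj \<Rightarrow>
   ('x \<times> 'q, 'xm \<times> 'qm, 'y, 'ym) func \<Rightarrow> ('c \<times> 'p \<Rightarrow> 'ym) \<Rightarrow> 'c \<times> 'q \<Rightarrow> 'ym"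
  where "hopf_trans A A' B V lam =
    (V \<triangleright> (id_trans (rcat A) (ladj A) \<times>\<^sub>t counit A') \<bullet>\<^bsub>rcat B\<^esub>
     lam \<triangleleft> ((id_func :: ('c, 'cm, 'c, 'cm) func) \<times>\<^sub>f radj A'))"

fun left_hopf ::
  "('c, 'cm, 'x, 'xm) adj \<Rightarrow> ('p, 'pm, 'q, 'qm) adj \<Rightarrow> ('d, 'dm, 'y, 'ym) adj \<Rightarrow>
   ('c \<times> 'p, 'cm \<times> 'pm, 'x \<times> 'q, 'xm \<times> 'qm, 'd, 'dm, 'y, 'ym) cell \<Rightarrow> bool"
  where "left_hopf A A' B (J, V, lam) \<longleftrightarrow>
    one_cell (A \<times>\<^sub>a A') B (J, V, lam) \<and>
    invertible_trans (lcat A \<times>\<^sub>c rcat A') (rcat B)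
      (ladj B \<circ>\<^sub>f J \<circ>\<^sub>f (id_func \<times>\<^sub>f radj A')) (V \<circ>\<^sub>f (ladj A \<times>\<^sub>f id_func))
      (hopf_trans A A' B V lam)"

definition hopf_trans_at ::
  "('c, 'cm, 'x, 'xm) adj \<Rightarrow> ('p, 'pm, 'q, 'qm) adj \<Rightarrow> ('d, 'dm, 'y, 'ym) adj \<Rightarrow>
   ('x \<times> 'q, 'xm \<times> 'qm, 'y, 'ym) func \<Rightarrow> ('c \<times> 'p \<Rightarrow> 'ym) \<Rightarrow> 'q \<Rightarrow> 'c \<Rightarrow> 'ym"
  where "hopf_trans_at A A' B V lam q = (\<lambda>c. hopf_trans A A' B V lam (c, q))"

text \<open>\<open>\<eta>VW\<close> is the family of units of \<open>V(-,q) \<stileturn> W(q,-)\<close>, and \<open>\<epsilon>JK\<close> the family of counits of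
  \<open>J(-,p) \<stileturn> K(p,-)\<close>.\<close>

definition right_hopf_trans_at ::
  "('c, 'cm, 'x, 'xm) adj \<Rightarrow> ('p, 'pm, 'q, 'qm) adj \<Rightarrow> ('d, 'dm, 'y, 'ym) adj \<Rightarrow>
   ('x \<times> 'q, 'xm \<times> 'qm, 'y, 'ym) func \<Rightarrow> ('c \<times> 'p \<Rightarrow> 'ym) \<Rightarrow>
   ('p \<times> 'd, 'pm \<times> 'dm, 'c, 'cm) func \<Rightarrow> ('q \<times> 'y, 'qm \<times> 'ym, 'x, 'xm) func \<Rightarrow>
   ('p \<Rightarrow> 'd \<Rightarrow> 'dm) \<Rightarrow> ('q \<Rightarrow> 'x \<Rightarrow> 'xm) \<Rightarrow> 'q \<Rightarrow> 'd \<Rightarrow> 'xm"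
  where "right_hopf_trans_at A A' B V lam K W \<epsilon>JK \<eta>VW q =
    (let Kq = fix_fst (lcat A') K (FOb (radj A') q);
         Wq = fix_fst (rcat A') W q
     in Wq \<circ>\<^sub>f ladj B \<triangleright> \<epsilon>JK (FOb (radj A') q) \<bullet>\<^bsub>rcat A\<^esub>
        Wq \<triangleright> inv_trans (rcat B) (hopf_trans_at A A' B V lam q) \<triangleleft> Kq \<bullet>\<^bsub>rcat A\<^esub>
        \<eta>VW q \<triangleleft> (ladj A \<circ>\<^sub>f Kq))"

definition right_hopf_trans ::
  "('c, 'cm, 'x, 'xm) adj \<Rightarrow> ('p, 'pm, 'q, 'qm) adj \<Rightarrow> ('d, 'dm, 'y, 'ym) adj \<Rightarrow>
   ('x \<times> 'q, 'xm \<times> 'qm, 'y, 'ym) func \<Rightarrow> ('c \<times> 'p \<Rightarrow> 'ym) \<Rightarrow>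
   ('p \<times> 'd, 'pm \<times> 'dm, 'c, 'cm) func \<Rightarrow> ('q \<times> 'y, 'qm \<times> 'ym, 'x, 'xm) func \<Rightarrow>
   ('p \<Rightarrow> 'd \<Rightarrow> 'dm) \<Rightarrow> ('q \<Rightarrow> 'x \<Rightarrow> 'xm) \<Rightarrow> 'q \<times> 'd \<Rightarrow> 'xm"
  where "right_hopf_trans A A' B V lam K W \<epsilon>JK \<eta>VW =
    (\<lambda>(q, d). right_hopf_trans_at A A' B V lam K W \<epsilon>JK \<eta>VW q d)"

end

theory Submission
  imports Defs
begin

text \<open>Write \<open>Rt\<close>, \<open>L'\<close>, \<open>R'\<close> for the right adjoint on the parameters and for the two adjoints of
  the target. The right mate of \<open>H\<close> is a restriction of the right mate of \<open>lam\<close>, so it is invertible.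
  For fixed \<open>q\<close>, \<open>H(-,q)\<close> is an isomorphism from \<open>L' J(-, Rt q)\<close> to \<open>V(-,q) L\<close>, and these functors are
  left adjoint to \<open>K(Rt q,-) R'\<close> and \<open>R W(q,-)\<close>. The right mate of the left mate belonging to
  \<open>K\<close> and \<open>W\<close> is the conjugate of the inverse of \<open>H(-,q)\<close>, hence invertible.
  All remaining equations are checked after transposition under \<open>V(-,q) \<stileturn> W(q,-)\<close>, which turns that
  left mate into the inverse of \<open>H(-,q)\<close> followed by \<open>L'\<close> of the counit of \<open>J(-, Rt q) \<stileturn> K(Rt q,-)\<close>.
  Naturality in \<open>q\<close> then comes from the dinaturality of the counits of a parametric adjunction.\<close>

section \<open>Categories, functors and transformations\<close>

lemma in_Hom_iff: "f \<in> Hom C x y \<longleftrightarrow> f \<in> Ar C \<and> Dom C f = x \<and> Cod C f = y"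
  by (simp add: Hom_def)

lemma func_simps [simp]:
  "FOb id_func x = x" "FAr id_func f = f"
  "FOb (G \<circ>\<^sub>f F) x = FOb G (FOb F x)" "FAr (G \<circ>\<^sub>f F) f = FAr G (FAr F f)"
  "FOb (F \<times>\<^sub>f F') (x, x') = (FOb F x, FOb F' x')"
  "FAr (F \<times>\<^sub>f F') (f, f') = (FAr F f, FAr F' f')"
  "FOb (fix_snd P J p) c = FOb J (c, p)" "FAr (fix_snd P J p) g = FAr J (g, Idn P p)"
  "FOb (fix_fst P K p) d = FOb K (p, d)" "FAr (fix_fst P K p) h = FAr K (Idn P p, h)"
  by (simp_all add: id_func_def comp_func_def prod_func_def fix_snd_def fix_fst_def)

lemma trans_simps [simp]:
  "id_trans D F x = Idn D (FOb F x)"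
  "(\<tau> \<bullet>\<^bsub>D\<^esub> \<sigma>) y = \<tau> y \<cdot>\<^bsub>D\<^esub> \<sigma> y"
  "(G \<triangleright> \<upsilon>) z = FAr G (\<upsilon> z)"
  "(\<phi> \<triangleleft> F') w = \<phi> (FOb F' w)"
  "(\<psi> \<times>\<^sub>t \<chi>) (a, b) = (\<psi> a, \<chi> b)"
  by (simp_all add: id_trans_def vcomp_def whisker_left_def whisker_right_def prod_trans_def)

lemma prod_cat_simps [simp]:
  "Ob (C \<times>\<^sub>c D) = Ob C \<times> Ob D" "Ar (C \<times>\<^sub>c D) = Ar C \<times> Ar D"
  "Dom (C \<times>\<^sub>c D) (f, g) = (Dom C f, Dom D g)" "Cod (C \<times>\<^sub>c D) (f, g) = (Cod C f, Cod D g)"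
  "Idn (C \<times>\<^sub>c D) (x, y) = (Idn C x, Idn D y)"
  "(f', g') \<cdot>\<^bsub>C \<times>\<^sub>c D\<^esub> (f, g) = (f' \<cdot>\<^bsub>C\<^esub> f, g' \<cdot>\<^bsub>D\<^esub> g)"
  by (simp_all add: prod_cat_def)

lemma op_cat_simps [simp]:
  "Ob (op_cat C) = Ob C" "Ar (op_cat C) = Ar C"
  "Dom (op_cat C) = Cod C" "Cod (op_cat C) = Dom C" "Idn (op_cat C) = Idn C"
  "g \<cdot>\<^bsub>op_cat C\<^esub> f = f \<cdot>\<^bsub>C\<^esub> g"
  by (simp_all add: op_cat_def)

lemma adj_simps [simp]:
  "lcat (A \<times>\<^sub>a B) = lcat A \<times>\<^sub>c lcat B" "rcat (A \<times>\<^sub>a B) = rcat A \<times>\<^sub>c rcat B"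
  "ladj (A \<times>\<^sub>a B) = ladj A \<times>\<^sub>f ladj B" "radj (A \<times>\<^sub>a B) = radj A \<times>\<^sub>f radj B"
  "unit (A \<times>\<^sub>a B) = unit A \<times>\<^sub>t unit B" "counit (A \<times>\<^sub>a B) = counit A \<times>\<^sub>t counit B"
  "lcat (id_adj C) = C" "rcat (id_adj C) = C" "ladj (id_adj C) = id_func"
  "radj (id_adj C) = id_func" "unit (id_adj C) = Idn C" "counit (id_adj C) = Idn C"
  by (simp_all add: prod_adj_def id_adj_def)

lemma op_func_simp [simp]: "op_func F = F"
  by (simp add: op_func_def)

text \<open>Typing conditions are phrased with \<^const>\<open>Dom\<close> and \<^const>\<open>Cod\<close> instead of \<^const>\<open>Hom\<close>,
  so that the rules below have no extra variables in their premises and the simplifier can discharge them.\<close>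

lemma categoryI:
  assumes "\<And>f. f \<in> Ar C \<Longrightarrow> Dom C f \<in> Ob C" "\<And>f. f \<in> Ar C \<Longrightarrow> Cod C f \<in> Ob C"
    and "\<And>x. x \<in> Ob C \<Longrightarrow> Idn C x \<in> Ar C \<and> Dom C (Idn C x) = x \<and> Cod C (Idn C x) = x"
    and "\<And>f g. \<lbrakk>f \<in> Ar C; g \<in> Ar C; Cod C f = Dom C g\<rbrakk>
      \<Longrightarrow> g \<cdot>\<^bsub>C\<^esub> f \<in> Ar C \<and> Dom C (g \<cdot>\<^bsub>C\<^esub> f) = Dom C f \<and> Cod C (g \<cdot>\<^bsub>C\<^esub> f) = Cod C g"
    and "\<And>f. f \<in> Ar C \<Longrightarrow> f \<cdot>\<^bsub>C\<^esub> Idn C (Dom C f) = f"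
    and "\<And>f. f \<in> Ar C \<Longrightarrow> Idn C (Cod C f) \<cdot>\<^bsub>C\<^esub> f = f"
    and "\<And>f g h. \<lbrakk>f \<in> Ar C; g \<in> Ar C; h \<in> Ar C; Cod C f = Dom C g; Cod C g = Dom C h\<rbrakk>
      \<Longrightarrow> (h \<cdot>\<^bsub>C\<^esub> g) \<cdot>\<^bsub>C\<^esub> f = h \<cdot>\<^bsub>C\<^esub> (g \<cdot>\<^bsub>C\<^esub> f)"
  shows "category C"
  by unfold_locales (use assms in \<open>auto simp: in_Hom_iff\<close>)

section \<open>Composition and inverses in a category\<close>

context category
begin

lemma Dom_Cod_in_Ob [simp]: "f \<in> Ar C \<Longrightarrow> Dom C f \<in> Ob C" "f \<in> Ar C \<Longrightarrow> Cod C f \<in> Ob C"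
  by (simp_all add: Dom_in_Ob Cod_in_Ob)

lemma Idn_typing [simp]:
  assumes "x \<in> Ob C"
  shows "Idn C x \<in> Ar C" "Dom C (Idn C x) = x" "Cod C (Idn C x) = x"
  using Idn_in_Hom[OF assms] by (simp_all add: in_Hom_iff)

lemma Cmp_typing [simp]:
  assumes "f \<in> Ar C" "g \<in> Ar C" "Cod C f = Dom C g"
  shows "g \<cdot> f \<in> Ar C" "Dom C (g \<cdot> f) = Dom C f" "Cod C (g \<cdot> f) = Cod C g"
  using Cmp_in_Hom[of f "Dom C f" "Dom C g" g "Cod C g"] assms by (simp_all add: in_Hom_iff)

lemma Cmp_units [simp]:
  "\<lbrakk>f \<in> Ar C; Dom C f = x\<rbrakk> \<Longrightarrow> f \<cdot> Idn C x = f"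
  "\<lbrakk>f \<in> Ar C; Cod C f = x\<rbrakk> \<Longrightarrow> Idn C x \<cdot> f = f"
  by (auto intro: Cmp_Idn Idn_Cmp simp: in_Hom_iff)

lemma Cmp_assoc' [simp]:
  "\<lbrakk>f \<in> Ar C; g \<in> Ar C; h \<in> Ar C; Cod C f = Dom C g; Cod C g = Dom C h\<rbrakk>
    \<Longrightarrow> (h \<cdot> g) \<cdot> f = h \<cdot> (g \<cdot> f)"
  by (rule Cmp_assoc[of f "Dom C f" "Dom C g" g "Dom C h" h "Cod C h"]) (simp_all add: in_Hom_iff)

text \<open>Inverses are unique, because \<open>h\<close> equals \<open>h\<close> after
  \<open>f\<close> after \<open>g\<close>, which equals \<open>g\<close>. As
  \<open>inv_arrow\<close> is a definite description, it can thus be evaluated by exhibiting any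
  inverse.\<close>

lemma inv_arrow_eqI:
  assumes "inverse_arrows C f g"
  shows "inv_arrow C f = g"
  unfolding inv_arrow_def
proof (rule the_equality)
  fix h assume h: "inverse_arrows C f h"
  have f: "f \<in> Ar C" and g: "g \<in> Ar C" "Dom C g = Cod C f" "Cod C g = Dom C f"
    and h: "h \<in> Ar C" "Dom C h = Cod C f" "Cod C h = Dom C f"
    and inv: "h \<cdot> f = Idn C (Dom C f)" "f \<cdot> g = Idn C (Cod C f)"
    using assms h by (auto simp: inverse_arrows_def in_Hom_iff)
  have "h = h \<cdot> (f \<cdot> g)"
    using f h by (simp add: inv)
  also have "\<dots> = (h \<cdot> f) \<cdot> g"
    using f g h by simp
  also have "\<dots> = g"
    using f g by (simp add: inv del: Cmp_assoc')
  finally show "h = g" .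
qed (rule assms)

lemma inverse_arrows_Idn: "x \<in> Ob C \<Longrightarrow> inverse_arrows C (Idn C x) (Idn C x)"
  by (simp add: inverse_arrows_def in_Hom_iff)

end

lemma (in category) inverse_arrows_Cmp:
  assumes "inverse_arrows C f f'" "inverse_arrows C g g'" "Cod C f = Dom C g"
  shows "inverse_arrows C (g \<cdot> f) (f' \<cdot> g')"
proof -
  have typing [simp]: "f \<in> Ar C" "f' \<in> Ar C" "Dom C f' = Cod C f" "Cod C f' = Dom C f"
    "g \<in> Ar C" "g' \<in> Ar C" "Dom C g' = Cod C g" "Cod C g' = Dom C g"
    and inv: "f' \<cdot> f = Idn C (Dom C f)" "f \<cdot> f' = Idn C (Cod C f)"
      "g' \<cdot> g = Idn C (Dom C g)" "g \<cdot> g' = Idn C (Cod C g)"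
    using assms by (auto simp: inverse_arrows_def in_Hom_iff)
  have "(f' \<cdot> g') \<cdot> (g \<cdot> f) = f' \<cdot> ((g' \<cdot> g) \<cdot> f)" "(g \<cdot> f) \<cdot> (f' \<cdot> g') = g \<cdot> ((f \<cdot> f') \<cdot> g')"
    using assms(3) by simp_all
  then show ?thesis
    using assms(3) unfolding inverse_arrows_def in_Hom_iff
    by (simp add: inv del: Cmp_assoc')
qed

section \<open>Products, opposites and functors\<close>

lemma category_prod [intro]:
  assumes "category C" "category D"
  shows "category (C \<times>\<^sub>c D)"
proof -
  interpret C: category C by fact
  interpret D: category D by fact
  show ?thesis
    by (rule categoryI) auto
qed

lemma category_op [intro]:
  assumes "category C"
  shows "category (op_cat C)"
proof -
  interpret C: category C by fact
  show ?thesis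
    by (rule categoryI) auto
qed

lemma cat_functorI:
  assumes "category C" "category D"
    and "\<And>x. x \<in> Ob C \<Longrightarrow> FOb F x \<in> Ob D"
    and "\<And>f. f \<in> Ar C \<Longrightarrow> FAr F f \<in> Ar D \<and>
      Dom D (FAr F f) = FOb F (Dom C f) \<and> Cod D (FAr F f) = FOb F (Cod C f)"
    and "\<And>x. x \<in> Ob C \<Longrightarrow> FAr F (Idn C x) = Idn D (FOb F x)"
    and "\<And>f g. \<lbrakk>f \<in> Ar C; g \<in> Ar C; Cod C f = Dom C g\<rbrakk>
      \<Longrightarrow> FAr F (g \<cdot>\<^bsub>C\<^esub> f) = FAr F g \<cdot>\<^bsub>D\<^esub> FAr F f"
  shows "cat_functor C D F"
  by (intro cat_functor.intro cat_functor_axioms.intro) (use assms in \<open>auto simp: in_Hom_iff\<close>)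

context cat_functor
begin

lemma FOb_typing [simp]: "x \<in> Ob C \<Longrightarrow> FOb F x \<in> Ob D"
  by (rule FOb_in_Ob)

lemma FAr_typing [simp]:
  assumes "f \<in> Ar C"
  shows "FAr F f \<in> Ar D" "Dom D (FAr F f) = FOb F (Dom C f)" "Cod D (FAr F f) = FOb F (Cod C f)"
  using FAr_in_Hom[of f "Dom C f" "Cod C f"] assms by (simp_all add: in_Hom_iff)

lemma FAr_Idn' [simp]: "x \<in> Ob C \<Longrightarrow> FAr F (Idn C x) = Idn D (FOb F x)"
  by (rule FAr_Idn)

lemma FAr_Cmp' [simp]:
  "\<lbrakk>f \<in> Ar C; g \<in> Ar C; Cod C f = Dom C g\<rbrakk> \<Longrightarrow> FAr F (g \<cdot>\<^bsub>C\<^esub> f) = FAr F g \<cdot>\<^bsub>D\<^esub> FAr F f"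
  by (rule FAr_Cmp) (auto simp: in_Hom_iff)

end

lemma (in cat_functor) inverse_arrows_FAr:
  assumes "inverse_arrows C f g"
  shows "inverse_arrows D (FAr F f) (FAr F g)"
proof -
  have [simp]: "f \<in> Ar C" "g \<in> Ar C" "Dom C g = Cod C f" "Cod C g = Dom C f"
    and inv: "g \<cdot>\<^bsub>C\<^esub> f = Idn C (Dom C f)" "f \<cdot>\<^bsub>C\<^esub> g = Idn C (Cod C f)"
    using assms by (auto simp: inverse_arrows_def in_Hom_iff)
  show ?thesis
    by (simp add: inverse_arrows_def in_Hom_iff FAr_Cmp'[symmetric] inv del: FAr_Cmp')
qed

lemma cat_functor_id: "category C \<Longrightarrow> cat_functor C C id_func"
  by (rule cat_functorI) (auto simp: category.Dom_in_Ob)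

lemma cat_functor_comp:
  assumes "cat_functor C D F" "cat_functor D E G"
  shows "cat_functor C E (G \<circ>\<^sub>f F)"
proof -
  interpret F: cat_functor C D F by fact
  interpret G: cat_functor D E G by fact
  show ?thesis
    by (rule cat_functorI) (auto intro: F.source.category_axioms G.target.category_axioms)
qed

lemma cat_functor_prod:
  assumes "cat_functor C D F" "cat_functor C' D' F'"
  shows "cat_functor (C \<times>\<^sub>c C') (D \<times>\<^sub>c D') (F \<times>\<^sub>f F')"
proof -
  interpret F: cat_functor C D F by fact
  interpret F': cat_functor C' D' F' by fact
  show ?thesis
    by (rule cat_functorI) (auto intro: F.source.category_axioms F.target.category_axioms
      F'.source.category_axioms F'.target.category_axioms)
qed

lemma cat_functor_op:
  assumes "cat_functor C D F"
  shows "cat_functor (op_cat C) (op_cat D) F"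
proof -
  interpret F: cat_functor C D F by fact
  show ?thesis
    by (rule cat_functorI) (auto intro: F.source.category_axioms F.target.category_axioms)
qed

text \<open>Oriented so that two values of a bifunctor merge into one. With identities in suitable
  slots it yields the interchange of the two arguments.\<close>

lemma bifunctor_Cmp:
  assumes "cat_functor (C \<times>\<^sub>c P) D J" "f \<in> Ar C" "g \<in> Ar C" "f' \<in> Ar P" "g' \<in> Ar P"
    "Cod C f = Dom C g" "Cod P f' = Dom P g'"
  shows "FAr J (g, g') \<cdot>\<^bsub>D\<^esub> FAr J (f, f') = FAr J (g \<cdot>\<^bsub>C\<^esub> f, g' \<cdot>\<^bsub>P\<^esub> f')"
  using cat_functor.FAr_Cmp'[OF assms(1), of "(f, f')" "(g, g')"] assms by simp

lemma cat_functor_fix_snd: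
  assumes "category C" "category P" "cat_functor (C \<times>\<^sub>c P) D J" "p \<in> Ob P"
  shows "cat_functor C D (fix_snd P J p)"
proof -
  interpret C: category C by fact
  interpret P: category P by fact
  interpret J: cat_functor "C \<times>\<^sub>c P" D J by fact
  show ?thesis
    using assms J.FAr_Idn[of "(_, p)"]
    by (intro cat_functorI) (auto simp: bifunctor_Cmp intro: J.target.category_axioms)
qed

section \<open>Natural transformations and pointwise inverses\<close>

lemma nat_transI:
  assumes "cat_functor C D F" "cat_functor C D G"
    and "\<And>x. x \<in> Ob C \<Longrightarrow> \<tau> x \<in> Ar D \<and> Dom D (\<tau> x) = FOb F x \<and> Cod D (\<tau> x) = FOb G x"
    and "\<And>f. f \<in> Ar C \<Longrightarrow> \<tau> (Cod C f) \<cdot>\<^bsub>D\<^esub> FAr F f = FAr G f \<cdot>\<^bsub>D\<^esub> \<tau> (Dom C f)"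
  shows "nat_trans C D F G \<tau>"
  by (intro nat_trans.intro nat_trans_axioms.intro) (use assms in \<open>auto simp: in_Hom_iff\<close>)

context nat_trans
begin

lemma component_typing [simp]:
  assumes "x \<in> Ob C"
  shows "\<tau> x \<in> Ar D" "Dom D (\<tau> x) = FOb F x" "Cod D (\<tau> x) = FOb G x"
  using component_in_Hom[OF assms] by (simp_all add: in_Hom_iff)

lemma naturality':
  "\<lbrakk>f \<in> Ar C; Cod C f = y\<rbrakk> \<Longrightarrow> \<tau> y \<cdot>\<^bsub>D\<^esub> FAr F f = FAr G f \<cdot>\<^bsub>D\<^esub> \<tau> (Dom C f)"
  by (rule naturality) (simp add: in_Hom_iff)

text \<open>Composites are normalised by bracketing to the right, so a naturality square often
  occurs with a tail \<open>h\<close>; this is the form that applies there.\<close>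

lemma naturality_assoc:
  assumes "f \<in> Ar C" "Cod C f = y" "h \<in> Ar D" "Cod D h = FOb F (Dom C f)"
  shows "\<tau> y \<cdot>\<^bsub>D\<^esub> (FAr F f \<cdot>\<^bsub>D\<^esub> h) = FAr G f \<cdot>\<^bsub>D\<^esub> (\<tau> (Dom C f) \<cdot>\<^bsub>D\<^esub> h)"
proof -
  have "\<tau> y \<cdot>\<^bsub>D\<^esub> (FAr F f \<cdot>\<^bsub>D\<^esub> h) = (\<tau> y \<cdot>\<^bsub>D\<^esub> FAr F f) \<cdot>\<^bsub>D\<^esub> h"
    using assms by auto
  also have "\<dots> = (FAr G f \<cdot>\<^bsub>D\<^esub> \<tau> (Dom C f)) \<cdot>\<^bsub>D\<^esub> h"
    using assms by (simp only: naturality')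
  finally show ?thesis
    using assms by simp
qed

text \<open>Pointwise inverses of a natural transformation are natural: insert \<open>\<tau>\<close>
  after \<open>\<sigma>\<close> at the source of \<open>f\<close>, slide \<open>\<tau>\<close> past
  \<open>f\<close>, and cancel \<open>\<sigma>\<close> against \<open>\<tau>\<close> at the target.
  Invertibility can therefore be checked one object at a time.\<close>

lemma invertible_transI:
  assumes "\<And>x. x \<in> Ob C \<Longrightarrow> \<exists>g. inverse_arrows D (\<tau> x) g"
  shows "invertible_trans C D F G \<tau>"
proof -
  obtain \<sigma> where \<sigma>: "\<And>x. x \<in> Ob C \<Longrightarrow> inverse_arrows D (\<tau> x) (\<sigma> x)"
    using assms by metis
  have \<sigma>_typing [simp]: "\<sigma> x \<in> Ar D" "Dom D (\<sigma> x) = FOb G x" "Cod D (\<sigma> x) = FOb F x"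
    and inv: "\<sigma> x \<cdot>\<^bsub>D\<^esub> \<tau> x = Idn D (FOb F x)" "\<tau> x \<cdot>\<^bsub>D\<^esub> \<sigma> x = Idn D (FOb G x)"
    if "x \<in> Ob C" for x
    using \<sigma>[OF that] that by (auto simp: inverse_arrows_def in_Hom_iff)
  have "nat_trans C D G F \<sigma>"
  proof (rule nat_transI)
    fix f assume f: "f \<in> Ar C"
    let ?x = "Dom C f" and ?y = "Cod C f"
    have "\<sigma> ?y \<cdot>\<^bsub>D\<^esub> FAr G f = \<sigma> ?y \<cdot>\<^bsub>D\<^esub> (FAr G f \<cdot>\<^bsub>D\<^esub> (\<tau> ?x \<cdot>\<^bsub>D\<^esub> \<sigma> ?x))"
      using f by (simp add: inv)
    also have "\<dots> = \<sigma> ?y \<cdot>\<^bsub>D\<^esub> (\<tau> ?y \<cdot>\<^bsub>D\<^esub> (FAr F f \<cdot>\<^bsub>D\<^esub> \<sigma> ?x))"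
      using f by (simp add: naturality_assoc)
    also have "\<dots> = (\<sigma> ?y \<cdot>\<^bsub>D\<^esub> \<tau> ?y) \<cdot>\<^bsub>D\<^esub> (FAr F f \<cdot>\<^bsub>D\<^esub> \<sigma> ?x)"
      using f by simp
    also have "\<dots> = FAr F f \<cdot>\<^bsub>D\<^esub> \<sigma> ?x"
      using f by (simp add: inv del: F.target.Cmp_assoc')
    finally show "\<sigma> ?y \<cdot>\<^bsub>D\<^esub> FAr G f = FAr F f \<cdot>\<^bsub>D\<^esub> \<sigma> ?x" .
  qed (simp_all add: F.cat_functor_axioms G.cat_functor_axioms)
  then show ?thesis
    using \<sigma> nat_trans_axioms unfolding invertible_trans_def by blast
qed

end

lemma invertible_transD:
  assumes "invertible_trans C D F G \<tau>"
  shows "nat_trans C D F G \<tau>" "\<And>x. x \<in> Ob C \<Longrightarrow> \<exists>g. inverse_arrows D (\<tau> x) g"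
  using assms by (auto simp: invertible_trans_def)

text \<open>By uniqueness of inverses, \<open>inv_trans\<close> agrees on all objects of
  \<open>C\<close> with a natural inverse, and naturality depends only on the values there.\<close>

lemma nat_trans_inv_trans:
  assumes "invertible_trans C D F G \<tau>"
  shows "nat_trans C D G F (inv_trans D \<tau>)"
proof -
  obtain \<sigma> where \<sigma>: "nat_trans C D G F \<sigma>" "\<And>x. x \<in> Ob C \<Longrightarrow> inverse_arrows D (\<tau> x) (\<sigma> x)"
    using assms by (auto simp: invertible_trans_def)
  interpret \<sigma>: nat_trans C D G F \<sigma> by (rule \<sigma>)
  have "inv_trans D \<tau> x = \<sigma> x" if "x \<in> Ob C" for x
    using \<sigma>(2)[OF that] by (simp add: inv_trans_def \<sigma>.F.target.inv_arrow_eqI)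
  then show ?thesis
    by (intro nat_transI \<sigma>.F.cat_functor_axioms \<sigma>.G.cat_functor_axioms)
      (simp_all add: \<sigma>.naturality')
qed

lemma nat_trans_fix_snd:
  assumes "category C" "category P" "nat_trans (C \<times>\<^sub>c P) D F G \<tau>" "p \<in> Ob P"
  shows "nat_trans C D (fix_snd P F p) (fix_snd P G p) (\<lambda>c. \<tau> (c, p))"
proof -
  interpret C: category C by fact
  interpret P: category P by fact
  interpret \<tau>: nat_trans "C \<times>\<^sub>c P" D F G \<tau> by fact
  show ?thesis
    using assms \<tau>.naturality'[of "(_, Idn P p)"]
    by (intro nat_transI cat_functor_fix_snd)
      (auto intro: \<tau>.F.cat_functor_axioms \<tau>.G.cat_functor_axioms)
qed

section \<open>Adjunctions and mates\<close>

text \<open>The content of \<open>adjunction\<close> with the data as separate parameters instead of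
  a record and with the triangle identities written in components. Adjunctions built from products
  or from a fixed parameter can then be used directly.\<close>

locale adjoint_pair =
  L: cat_functor C X L + R: cat_functor X C R +
  unit: nat_trans C C id_func "R \<circ>\<^sub>f L" \<eta> + counit: nat_trans X X "L \<circ>\<^sub>f R" id_func \<epsilon>
  for C :: "('c, 'cm) cat" and X :: "('x, 'xm) cat" and L R \<eta> \<epsilon> +
  assumes triangle_L: "c \<in> Ob C \<Longrightarrow> \<epsilon> (FOb L c) \<cdot>\<^bsub>X\<^esub> FAr L (\<eta> c) = Idn X (FOb L c)"
    and triangle_R: "x \<in> Ob X \<Longrightarrow> FAr R (\<epsilon> x) \<cdot>\<^bsub>C\<^esub> \<eta> (FOb R x) = Idn C (FOb R x)"
begin

lemmas unit_natural = unit.naturality'[simplified] unit.naturality_assoc[simplified]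
lemmas counit_natural = counit.naturality'[simplified] counit.naturality_assoc[simplified]

text \<open>Naturality of the counit at \<open>h\<close>, followed by the triangle identity at
  \<open>c\<close>: transposing \<open>h\<close> to an arrow into \<open>R\<close> and back returns
  \<open>h\<close>.\<close>

lemma transpose_eq:
  assumes "h \<in> Ar X" "Dom X h = FOb L c" "Cod X h = x" "c \<in> Ob C"
  shows "\<epsilon> x \<cdot>\<^bsub>X\<^esub> FAr L (FAr R h \<cdot>\<^bsub>C\<^esub> \<eta> c) = h"
  using assms by (auto simp: counit_natural triangle_L)

text \<open>An arrow into \<open>FOb R x\<close> is recovered from its transpose by applying
  \<open>R\<close> and precomposing with the unit. Most equations below are proved by comparing
  transposes with this lemma.\<close>

lemma transpose_inj:
  assumes "f \<in> Ar C" "g \<in> Ar C" "Dom C f = Dom C g" "x \<in> Ob X"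
    and "Cod C f = FOb R x" "Cod C g = FOb R x"
    and eq: "\<epsilon> x \<cdot>\<^bsub>X\<^esub> FAr L f = \<epsilon> x \<cdot>\<^bsub>X\<^esub> FAr L g"
  shows "f = g"
proof -
  have recover: "h = FAr R (\<epsilon> x \<cdot>\<^bsub>X\<^esub> FAr L h) \<cdot>\<^bsub>C\<^esub> \<eta> (Dom C h)"
    if h: "h \<in> Ar C" "Cod C h = FOb R x" for h
  proof -
    have "FAr R (\<epsilon> x \<cdot>\<^bsub>X\<^esub> FAr L h) \<cdot>\<^bsub>C\<^esub> \<eta> (Dom C h) = FAr R (\<epsilon> x) \<cdot>\<^bsub>C\<^esub> (\<eta> (FOb R x) \<cdot>\<^bsub>C\<^esub> h)"
      using h \<open>x \<in> Ob X\<close> by (simp add: unit_natural)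
    also have "\<dots> = (FAr R (\<epsilon> x) \<cdot>\<^bsub>C\<^esub> \<eta> (FOb R x)) \<cdot>\<^bsub>C\<^esub> h"
      using h \<open>x \<in> Ob X\<close> by simp
    also have "\<dots> = h"
      using h \<open>x \<in> Ob X\<close> by (simp add: triangle_R del: L.source.Cmp_assoc')
    finally show ?thesis by simp
  qed
  from recover[of f] recover[of g] show ?thesis
    using assms by simp
qed

end

lemma adjunction_iff:
  "adjunction A \<longleftrightarrow> adjoint_pair (lcat A) (rcat A) (ladj A) (radj A) (unit A) (counit A)"
  unfolding adjunction_def adjoint_pair_def adjoint_pair_axioms_def by auto

lemma adjoint_pair_prod:
  assumes "adjoint_pair C X L R \<eta> \<epsilon>" "adjoint_pair C' X' L' R' \<eta>' \<epsilon>'"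
  shows "adjoint_pair (C \<times>\<^sub>c C') (X \<times>\<^sub>c X') (L \<times>\<^sub>f L') (R \<times>\<^sub>f R') (\<eta> \<times>\<^sub>t \<eta>') (\<epsilon> \<times>\<^sub>t \<epsilon>')"
proof -
  interpret A: adjoint_pair C X L R \<eta> \<epsilon> by fact
  interpret A': adjoint_pair C' X' L' R' \<eta>' \<epsilon>' by fact
  have F: "cat_functor (C \<times>\<^sub>c C') (X \<times>\<^sub>c X') (L \<times>\<^sub>f L')" "cat_functor (X \<times>\<^sub>c X') (C \<times>\<^sub>c C') (R \<times>\<^sub>f R')"
    by (intro cat_functor_prod A.L.cat_functor_axioms A'.L.cat_functor_axioms
      A.R.cat_functor_axioms A'.R.cat_functor_axioms)+
  show ?thesis
    by (intro adjoint_pair.intro adjoint_pair_axioms.intro nat_transI cat_functor_id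
        cat_functor_comp[OF F] cat_functor_comp[OF F(2) F(1)] F category_prod
        A.L.source.category_axioms A.L.target.category_axioms
        A'.L.source.category_axioms A'.L.target.category_axioms)
      (auto simp: A.unit_natural A.counit_natural A'.unit_natural A'.counit_natural
        A.triangle_L A.triangle_R A'.triangle_L A'.triangle_R)
qed

lemma adjoint_pair_id:
  assumes "category C"
  shows "adjoint_pair C C id_func id_func (Idn C) (Idn C)"
proof -
  interpret C: category C by fact
  show ?thesis
    by (intro adjoint_pair.intro adjoint_pair_axioms.intro nat_transI cat_functor_id
      cat_functor_comp[OF cat_functor_id] assms) auto
qed

text \<open>The data of a 1-cell without invertibility of the right mate, which
  \<open>one_cell_iff\<close> adds as a pointwise condition.\<close>

locale mate_square =
  A: adjoint_pair C X L R \<eta> \<epsilon> + B: adjoint_pair D Y L' R' \<eta>' \<epsilon>' +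
  J: cat_functor C D J + V: cat_functor X Y V +
  lam: nat_trans C Y "L' \<circ>\<^sub>f J" "V \<circ>\<^sub>f L" lam
  for C :: "('c, 'cm) cat" and X :: "('x, 'xm) cat" and L R \<eta> \<epsilon>
    and D :: "('d, 'dm) cat" and Y :: "('y, 'ym) cat" and L' R' \<eta>' \<epsilon>'
    and J V lam
begin

definition mate :: "'x \<Rightarrow> 'dm"
  where "mate x = FAr R' (FAr V (\<epsilon> x)) \<cdot>\<^bsub>D\<^esub> (FAr R' (lam (FOb R x)) \<cdot>\<^bsub>D\<^esub> \<eta>' (FOb J (FOb R x)))"

lemmas lam_natural = lam.naturality'[simplified] lam.naturality_assoc[simplified]

lemma mate_typing [simp]:
  assumes "x \<in> Ob X"
  shows "mate x \<in> Ar D" "Dom D (mate x) = FOb J (FOb R x)" "Cod D (mate x) = FOb R' (FOb V x)"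
  using assms by (simp_all add: mate_def)

text \<open>The mate is by definition the transpose, under \<open>L' \<stileturn> R'\<close>, of the
  right-hand side; \<open>transpose_eq\<close> undoes this transposition.\<close>

lemma transpose_mate:
  assumes x: "x \<in> Ob X"
  shows "\<epsilon>' (FOb V x) \<cdot>\<^bsub>Y\<^esub> FAr L' (mate x) = FAr V (\<epsilon> x) \<cdot>\<^bsub>Y\<^esub> lam (FOb R x)"
  using B.transpose_eq[of "FAr V (\<epsilon> x) \<cdot>\<^bsub>Y\<^esub> lam (FOb R x)" "FOb J (FOb R x)" "FOb V x"] x
  by (simp add: mate_def)

lemma mate_eqI:
  assumes "x \<in> Ob X" "f \<in> Ar D" "Dom D f = FOb J (FOb R x)" "Cod D f = FOb R' (FOb V x)"
    and "\<epsilon>' (FOb V x) \<cdot>\<^bsub>Y\<^esub> FAr L' f = FAr V (\<epsilon> x) \<cdot>\<^bsub>Y\<^esub> lam (FOb R x)"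
  shows "mate x = f"
  by (rule B.transpose_inj[of _ _ "FOb V x"]) (use assms in \<open>simp_all add: transpose_mate\<close>)

text \<open>Both sides of the naturality square have the same transpose under
  \<open>L' \<stileturn> R'\<close>, by naturality of \<open>lam\<close> and of the two
  counits.\<close>

lemma mate_nat_trans: "nat_trans X D (J \<circ>\<^sub>f R) (R' \<circ>\<^sub>f V) mate"
proof (rule nat_transI)
  fix f assume f: "f \<in> Ar X"
  let ?x = "Dom X f" and ?y = "Cod X f"
  have "\<epsilon>' (FOb V ?y) \<cdot>\<^bsub>Y\<^esub> FAr L' (mate ?y \<cdot>\<^bsub>D\<^esub> FAr J (FAr R f))
      = (\<epsilon>' (FOb V ?y) \<cdot>\<^bsub>Y\<^esub> FAr L' (mate ?y)) \<cdot>\<^bsub>Y\<^esub> FAr L' (FAr J (FAr R f))"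
    using f by simp
  also have "\<dots> = FAr V (\<epsilon> ?y \<cdot>\<^bsub>X\<^esub> FAr L (FAr R f)) \<cdot>\<^bsub>Y\<^esub> lam (FOb R ?x)"
    using f by (simp add: transpose_mate lam_natural)
  also have "\<dots> = FAr V f \<cdot>\<^bsub>Y\<^esub> (\<epsilon>' (FOb V ?x) \<cdot>\<^bsub>Y\<^esub> FAr L' (mate ?x))"
    using f by (simp add: A.counit_natural transpose_mate del: V.FAr_Cmp') (simp add: f)
  also have "\<dots> = \<epsilon>' (FOb V ?y) \<cdot>\<^bsub>Y\<^esub> FAr L' (FAr R' (FAr V f) \<cdot>\<^bsub>D\<^esub> mate ?x)"
    using f by (simp add: B.counit_natural)
  finally have "mate ?y \<cdot>\<^bsub>D\<^esub> FAr J (FAr R f) = FAr R' (FAr V f) \<cdot>\<^bsub>D\<^esub> mate ?x"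
    by (intro B.transpose_inj[of _ _ "FOb V ?y"]) (use f in simp_all)
  then show "mate ?y \<cdot>\<^bsub>D\<^esub> FAr (J \<circ>\<^sub>f R) f = FAr (R' \<circ>\<^sub>f V) f \<cdot>\<^bsub>D\<^esub> mate ?x"
    by simp
qed (auto intro: cat_functor_comp A.R.cat_functor_axioms J.cat_functor_axioms
  V.cat_functor_axioms B.R.cat_functor_axioms)

end

section \<open>Identity and composite 1-cells\<close>

abbreviation mate_square_adj ::
  "('c, 'cm, 'x, 'xm) adj \<Rightarrow> ('d, 'dm, 'y, 'ym) adj \<Rightarrow> ('c, 'cm, 'd, 'dm) func \<Rightarrow>
   ('x, 'xm, 'y, 'ym) func \<Rightarrow> ('c \<Rightarrow> 'ym) \<Rightarrow> bool"
  where "mate_square_adj A B \<equiv> mate_square (lcat A) (rcat A) (ladj A) (radj A) (unit A) (counit A)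
    (lcat B) (rcat B) (ladj B) (radj B) (unit B) (counit B)"

abbreviation mate_adj ::
  "('c, 'cm, 'x, 'xm) adj \<Rightarrow> ('d, 'dm, 'y, 'ym) adj \<Rightarrow> ('c, 'cm, 'd, 'dm) func \<Rightarrow>
   ('x, 'xm, 'y, 'ym) func \<Rightarrow> ('c \<Rightarrow> 'ym) \<Rightarrow> 'x \<Rightarrow> 'dm"
  where "mate_adj A B \<equiv> mate_square.mate (radj A) (counit A) (lcat B) (radj B) (unit B)"

text \<open>Naturality of the right mate is automatic by \<open>mate_nat_trans\<close>, and
  pointwise inverses are automatically natural, so only an inverse at each object remains to be
  required.\<close>

lemma one_cell_iff:
  "one_cell A B (J, V, lam) \<longleftrightarrow> mate_square_adj A B J V lam \<and>
    (\<forall>x\<in>Ob (rcat A). \<exists>g. inverse_arrows (lcat B) (mate_adj A B J V lam x) g)"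
  (is "?lhs \<longleftrightarrow> ?rhs")
proof -
  have mate: "right_mate A B (J, V, lam) = mate_adj A B J V lam" if "mate_square_adj A B J V lam"
    using that by (auto simp: mate_square.mate_def)
  show ?thesis
  proof
    assume ?lhs
    then have "mate_square_adj A B J V lam"
      by (simp add: mate_square_def adjunction_iff)
    moreover from this mate \<open>?lhs\<close>
    have "invertible_trans (rcat A) (lcat B) (J \<circ>\<^sub>f radj A) (radj B \<circ>\<^sub>f V) (mate_adj A B J V lam)"
      by (simp only: one_cell.simps)
    ultimately show ?rhs
      by (auto dest: invertible_transD)
  next
    assume r: ?rhs
    then interpret mate_square "lcat A" "rcat A" "ladj A" "radj A" "unit A" "counit A"
      "lcat B" "rcat B" "ladj B" "radj B" "unit B" "counit B" J V lam
      by blast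
    have "invertible_trans (rcat A) (lcat B) (J \<circ>\<^sub>f radj A) (radj B \<circ>\<^sub>f V) mate"
      using r by (intro nat_trans.invertible_transI mate_nat_trans) auto
    then show ?lhs
      using r mate by (auto simp: adjunction_iff A.adjoint_pair_axioms B.adjoint_pair_axioms
        J.cat_functor_axioms V.cat_functor_axioms lam.nat_trans_axioms simp del: right_mate.simps)
  qed
qed

lemma mate_square_id:
  assumes "adjoint_pair C X L R \<eta> \<epsilon>"
  shows "mate_square C X L R \<eta> \<epsilon> C X L R \<eta> \<epsilon> id_func id_func (id_trans X L)"
proof -
  interpret adjoint_pair C X L R \<eta> \<epsilon> by fact
  have "cat_functor C X (L \<circ>\<^sub>f id_func)" "cat_functor C X (id_func \<circ>\<^sub>f L)"
    by (rule cat_functor_comp[OF cat_functor_id[OF L.source.category_axioms] L.cat_functor_axioms],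
      rule cat_functor_comp[OF L.cat_functor_axioms cat_functor_id[OF L.target.category_axioms]])
  then show ?thesis
    by (intro mate_square.intro assms cat_functor_id nat_transI
      L.source.category_axioms L.target.category_axioms) auto
qed

text \<open>The right mate of the identity cell is the identity, since both have the counit as
  transpose.\<close>

lemma one_cell_id:
  assumes "adjunction A"
  shows "one_cell A A (id_cell A)"
proof -
  interpret mate_square "lcat A" "rcat A" "ladj A" "radj A" "unit A" "counit A"
    "lcat A" "rcat A" "ladj A" "radj A" "unit A" "counit A" id_func id_func
    "id_trans (rcat A) (ladj A)"
    using assms by (intro mate_square_id) (simp add: adjunction_iff)
  have "mate x = Idn (lcat A) (FOb (radj A) x)" if "x \<in> Ob (rcat A)" for x
    by (rule mate_eqI) (use that in auto)
  then have "\<exists>g. inverse_arrows (lcat A) (mate x) g" if "x \<in> Ob (rcat A)" for x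
    using that A.L.source.inverse_arrows_Idn[of "FOb (radj A) x"] by auto
  then show ?thesis
    using mate_square_axioms by (simp add: id_cell_def one_cell_iff del: one_cell.simps)
qed

text \<open>The right mate of a composite is the composite of the right mates, suitably whiskered,
  and invertibility is preserved by functors and composition.\<close>

lemma one_cell_comp:
  assumes "one_cell A B (J, V, lam)" "one_cell B E (K, W, kap)"
  shows "one_cell A E (comp_cell E (K, W, kap) (J, V, lam))"
proof -
  interpret M: mate_square "lcat A" "rcat A" "ladj A" "radj A" "unit A" "counit A"
    "lcat B" "rcat B" "ladj B" "radj B" "unit B" "counit B" J V lam
    using assms by (simp add: one_cell_iff del: one_cell.simps)
  interpret N: mate_square "lcat B" "rcat B" "ladj B" "radj B" "unit B" "counit B"
    "lcat E" "rcat E" "ladj E" "radj E" "unit E" "counit E" K W kap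
    using assms by (simp add: one_cell_iff del: one_cell.simps)
  let ?lam = "W \<triangleright> lam \<bullet>\<^bsub>rcat E\<^esub> kap \<triangleleft> J"
  have F: "cat_functor (lcat A) (lcat E) (K \<circ>\<^sub>f J)" "cat_functor (rcat A) (rcat E) (W \<circ>\<^sub>f V)"
    by (rule cat_functor_comp[OF M.J.cat_functor_axioms N.J.cat_functor_axioms],
      rule cat_functor_comp[OF M.V.cat_functor_axioms N.V.cat_functor_axioms])
  have "nat_trans (lcat A) (rcat E) (ladj E \<circ>\<^sub>f K \<circ>\<^sub>f J) ((W \<circ>\<^sub>f V) \<circ>\<^sub>f ladj A) ?lam"
  proof (rule nat_transI)
    fix f assume f: "f \<in> Ar (lcat A)"
    then have "FAr W (lam (Cod (lcat A) f)) \<cdot>\<^bsub>rcat E\<^esub> FAr W (FAr (ladj B) (FAr J f))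
        = FAr W (FAr V (FAr (ladj A) f)) \<cdot>\<^bsub>rcat E\<^esub> FAr W (lam (Dom (lcat A) f))"
      by (simp add: M.lam_natural N.V.FAr_Cmp'[symmetric] del: N.V.FAr_Cmp')
    then have "(FAr W (lam (Cod (lcat A) f)) \<cdot>\<^bsub>rcat E\<^esub> FAr W (FAr (ladj B) (FAr J f)))
          \<cdot>\<^bsub>rcat E\<^esub> kap (FOb J (Dom (lcat A) f))
        = (FAr W (FAr V (FAr (ladj A) f)) \<cdot>\<^bsub>rcat E\<^esub> FAr W (lam (Dom (lcat A) f)))
          \<cdot>\<^bsub>rcat E\<^esub> kap (FOb J (Dom (lcat A) f))"
      by simp
    with f show "?lam (Cod (lcat A) f) \<cdot>\<^bsub>rcat E\<^esub> FAr (ladj E \<circ>\<^sub>f K \<circ>\<^sub>f J) f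
        = FAr ((W \<circ>\<^sub>f V) \<circ>\<^sub>f ladj A) f \<cdot>\<^bsub>rcat E\<^esub> ?lam (Dom (lcat A) f)"
      by (simp add: N.lam_natural)
  qed (auto intro!: cat_functor_comp F N.B.L.cat_functor_axioms M.A.L.cat_functor_axioms
    M.J.cat_functor_axioms N.J.cat_functor_axioms M.V.cat_functor_axioms N.V.cat_functor_axioms)
  then interpret MN: mate_square "lcat A" "rcat A" "ladj A" "radj A" "unit A" "counit A"
    "lcat E" "rcat E" "ladj E" "radj E" "unit E" "counit E" "K \<circ>\<^sub>f J" "W \<circ>\<^sub>f V" ?lam
    by (intro mate_square.intro F M.A.adjoint_pair_axioms N.B.adjoint_pair_axioms)
      (simp add: comp_func_def)
  \<comment> \<open>Taking transposes, naturality of \<open>kap\<close> moves the inner mate under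
    \<open>W\<close> and \<open>ladj B\<close>, where \<open>M.transpose_mate\<close> evaluates
    it.\<close>
  have mate: "MN.mate x = N.mate (FOb V x) \<cdot>\<^bsub>lcat E\<^esub> FAr K (M.mate x)"
    if x: "x \<in> Ob (rcat A)" for x
  proof (rule MN.mate_eqI)
    have "counit E (FOb W (FOb V x)) \<cdot>\<^bsub>rcat E\<^esub>
          FAr (ladj E) (N.mate (FOb V x) \<cdot>\<^bsub>lcat E\<^esub> FAr K (M.mate x))
        = (counit E (FOb W (FOb V x)) \<cdot>\<^bsub>rcat E\<^esub> FAr (ladj E) (N.mate (FOb V x)))
          \<cdot>\<^bsub>rcat E\<^esub> FAr (ladj E) (FAr K (M.mate x))"
      using x by simp
    also have "\<dots> = FAr W (counit B (FOb V x) \<cdot>\<^bsub>rcat B\<^esub> FAr (ladj B) (M.mate x))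
        \<cdot>\<^bsub>rcat E\<^esub> kap (FOb J (FOb (radj A) x))"
      using x by (simp add: N.transpose_mate N.lam_natural)
    also have "\<dots> = FAr (W \<circ>\<^sub>f V) (counit A x) \<cdot>\<^bsub>rcat E\<^esub> ?lam (FOb (radj A) x)"
      using x by (simp add: M.transpose_mate del: N.V.FAr_Cmp') simp
    finally show "counit E (FOb (W \<circ>\<^sub>f V) x) \<cdot>\<^bsub>rcat E\<^esub>
          FAr (ladj E) (N.mate (FOb V x) \<cdot>\<^bsub>lcat E\<^esub> FAr K (M.mate x))
        = FAr (W \<circ>\<^sub>f V) (counit A x) \<cdot>\<^bsub>rcat E\<^esub> ?lam (FOb (radj A) x)"
      by simp
  qed (use x in simp_all)
  have "\<exists>g. inverse_arrows (lcat E) (MN.mate x) g" if x: "x \<in> Ob (rcat A)" for x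
  proof -
    obtain g h where "inverse_arrows (lcat B) (M.mate x) g"
      "inverse_arrows (lcat E) (N.mate (FOb V x)) h"
      using x assms by (metis one_cell_iff M.V.FOb_in_Ob)
    then show ?thesis
      using x mate N.B.L.source.inverse_arrows_Cmp N.J.inverse_arrows_FAr by fastforce
  qed
  then show ?thesis
    using MN.mate_square_axioms by (simp add: one_cell_iff del: one_cell.simps)
qed

section \<open>Doctrinal adjunction\<close>

text \<open>The setting in which a right adjoint cell is constructed from an invertible left mate:
  \<open>lam\<close> itself, not its right mate, is taken to be invertible.\<close>

locale doctrinal_adjunction =
  mate_square C X L R \<eta> \<epsilon> D Y L' R' \<eta>' \<epsilon>' J V lam +
  JK: adjoint_pair C D J K \<eta>J \<epsilon>J + VW: adjoint_pair X Y V W \<eta>V \<epsilon>V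
  for C :: "('c, 'cm) cat" and X :: "('x, 'xm) cat" and L R \<eta> \<epsilon>
    and D :: "('d, 'dm) cat" and Y :: "('y, 'ym) cat" and L' R' \<eta>' \<epsilon>'
    and J V lam K \<eta>J \<epsilon>J W \<eta>V \<epsilon>V +
  assumes lam_invertible: "c \<in> Ob C \<Longrightarrow> \<exists>g. inverse_arrows Y (lam c) g"
begin

definition lam_inv :: "'c \<Rightarrow> 'ym"
  where "lam_inv c = inv_arrow Y (lam c)"

text \<open>The mate of \<open>lam_inv\<close> with respect to \<open>J \<stileturn> K\<close> and
  \<open>V \<stileturn> W\<close>. It will be the left mate of the cell formed by \<open>K\<close>
  and \<open>W\<close>.\<close>

definition kap :: "'d \<Rightarrow> 'xm"
  where "kap d = FAr W (FAr L' (\<epsilon>J d)) \<cdot>\<^bsub>X\<^esub> (FAr W (lam_inv (FOb K d)) \<cdot>\<^bsub>X\<^esub> \<eta>V (FOb L (FOb K d)))"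

lemma lam_inv: "c \<in> Ob C \<Longrightarrow> inverse_arrows Y (lam c) (lam_inv c)"
  using lam_invertible B.L.target.inv_arrow_eqI unfolding lam_inv_def by metis

lemma lam_inv_typing [simp]:
  assumes "c \<in> Ob C"
  shows "lam_inv c \<in> Ar Y" "Dom Y (lam_inv c) = FOb V (FOb L c)" "Cod Y (lam_inv c) = FOb L' (FOb J c)"
  using lam_inv[OF assms] assms by (simp_all add: inverse_arrows_def in_Hom_iff)

lemma lam_inv_cancel:
  assumes "c \<in> Ob C"
  shows "lam_inv c \<cdot>\<^bsub>Y\<^esub> lam c = Idn Y (FOb L' (FOb J c))" "lam c \<cdot>\<^bsub>Y\<^esub> lam_inv c = Idn Y (FOb V (FOb L c))"
  using lam_inv[OF assms] assms by (simp_all add: inverse_arrows_def)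

sublocale lam_inv: nat_trans C Y "V \<circ>\<^sub>f L" "L' \<circ>\<^sub>f J" lam_inv
  using nat_trans_inv_trans[OF lam.invertible_transI[OF lam_invertible]]
  by (simp add: inv_trans_def lam_inv_def[abs_def])

lemmas lam_inv_natural = lam_inv.naturality'[simplified] lam_inv.naturality_assoc[simplified]

lemma kap_typing [simp]:
  assumes "d \<in> Ob D"
  shows "kap d \<in> Ar X" "Dom X (kap d) = FOb L (FOb K d)" "Cod X (kap d) = FOb W (FOb L' d)"
  using assms by (simp_all add: kap_def)

lemma transpose_kap:
  assumes "d \<in> Ob D"
  shows "\<epsilon>V (FOb L' d) \<cdot>\<^bsub>Y\<^esub> FAr V (kap d) = FAr L' (\<epsilon>J d) \<cdot>\<^bsub>Y\<^esub> lam_inv (FOb K d)"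
  using VW.transpose_eq[of "FAr L' (\<epsilon>J d) \<cdot>\<^bsub>Y\<^esub> lam_inv (FOb K d)" "FOb L (FOb K d)" "FOb L' d"] assms
  by (simp add: kap_def)

text \<open>Both sides are transposed under \<open>V \<stileturn> W\<close>, where the claim becomes
  naturality of \<open>lam_inv\<close> and of the counit \<open>\<epsilon>J\<close>.\<close>

lemma kap_nat_trans: "nat_trans D X (L \<circ>\<^sub>f K) (W \<circ>\<^sub>f L') kap"
proof (rule nat_transI)
  fix g assume g: "g \<in> Ar D"
  let ?d = "Dom D g" and ?d' = "Cod D g"
  have "\<epsilon>V (FOb L' ?d') \<cdot>\<^bsub>Y\<^esub> FAr V (kap ?d' \<cdot>\<^bsub>X\<^esub> FAr L (FAr K g))
      = (\<epsilon>V (FOb L' ?d') \<cdot>\<^bsub>Y\<^esub> FAr V (kap ?d')) \<cdot>\<^bsub>Y\<^esub> FAr V (FAr L (FAr K g))"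
    using g by simp
  also have "\<dots> = FAr L' (\<epsilon>J ?d' \<cdot>\<^bsub>D\<^esub> FAr J (FAr K g)) \<cdot>\<^bsub>Y\<^esub> lam_inv (FOb K ?d)"
    using g by (simp add: transpose_kap lam_inv_natural)
  also have "\<dots> = FAr L' g \<cdot>\<^bsub>Y\<^esub> (\<epsilon>V (FOb L' ?d) \<cdot>\<^bsub>Y\<^esub> FAr V (kap ?d))"
    using g by (simp add: JK.counit_natural transpose_kap del: B.L.FAr_Cmp') (simp add: g)
  also have "\<dots> = \<epsilon>V (FOb L' ?d') \<cdot>\<^bsub>Y\<^esub> FAr V (FAr W (FAr L' g) \<cdot>\<^bsub>X\<^esub> kap ?d)"
    using g by (simp add: VW.counit_natural)
  finally have "kap ?d' \<cdot>\<^bsub>X\<^esub> FAr L (FAr K g) = FAr W (FAr L' g) \<cdot>\<^bsub>X\<^esub> kap ?d"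
    by (intro VW.transpose_inj[of _ _ "FOb L' ?d'"]) (use g in simp_all)
  then show "kap ?d' \<cdot>\<^bsub>X\<^esub> FAr (L \<circ>\<^sub>f K) g = FAr (W \<circ>\<^sub>f L') g \<cdot>\<^bsub>X\<^esub> kap ?d"
    by simp
qed (auto intro: cat_functor_comp A.L.cat_functor_axioms JK.R.cat_functor_axioms
  VW.R.cat_functor_axioms B.L.cat_functor_axioms)

sublocale kap: mate_square D Y L' R' \<eta>' \<epsilon>' C X L R \<eta> \<epsilon> K W kap
  by (intro mate_square.intro kap_nat_trans A.adjoint_pair_axioms B.adjoint_pair_axioms
    JK.R.cat_functor_axioms VW.R.cat_functor_axioms)

text \<open>By \<open>transpose_kap\<close> the left side contains \<open>lam_inv\<close> followed
  by \<open>L'\<close> of the counit, and \<open>lam\<close> cancels. This is the 2-cell condition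
  on the pair of counits.\<close>

lemma counit_two_cell:
  assumes "d \<in> Ob D"
  shows "\<epsilon>V (FOb L' d) \<cdot>\<^bsub>Y\<^esub> (FAr V (kap d) \<cdot>\<^bsub>Y\<^esub> lam (FOb K d)) = FAr L' (\<epsilon>J d)"
proof -
  have "\<epsilon>V (FOb L' d) \<cdot>\<^bsub>Y\<^esub> (FAr V (kap d) \<cdot>\<^bsub>Y\<^esub> lam (FOb K d))
      = (\<epsilon>V (FOb L' d) \<cdot>\<^bsub>Y\<^esub> FAr V (kap d)) \<cdot>\<^bsub>Y\<^esub> lam (FOb K d)"
    using assms by simp
  then show ?thesis
    using assms by (simp add: transpose_kap lam_inv_cancel)
qed

text \<open>The 2-cell condition on the pair of units. After transposition \<open>lam\<close> comes
  out on the left, the triangle identity of \<open>J \<stileturn> K\<close> removes unit and counit,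
  and \<open>lam\<close> cancels against \<open>lam_inv\<close>.\<close>

lemma unit_two_cell:
  assumes c: "c \<in> Ob C"
  shows "FAr W (lam c) \<cdot>\<^bsub>X\<^esub> (kap (FOb J c) \<cdot>\<^bsub>X\<^esub> FAr L (\<eta>J c)) = \<eta>V (FOb L c)"
proof -
  have "\<epsilon>V (FOb V (FOb L c)) \<cdot>\<^bsub>Y\<^esub> FAr V (FAr W (lam c) \<cdot>\<^bsub>X\<^esub> (kap (FOb J c) \<cdot>\<^bsub>X\<^esub> FAr L (\<eta>J c)))
      = lam c \<cdot>\<^bsub>Y\<^esub> ((\<epsilon>V (FOb L' (FOb J c)) \<cdot>\<^bsub>Y\<^esub> FAr V (kap (FOb J c))) \<cdot>\<^bsub>Y\<^esub> FAr V (FAr L (\<eta>J c)))"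
    using c by (simp add: VW.counit_natural)
  also have "\<dots> = lam c \<cdot>\<^bsub>Y\<^esub> (FAr L' (\<epsilon>J (FOb J c) \<cdot>\<^bsub>D\<^esub> FAr J (\<eta>J c)) \<cdot>\<^bsub>Y\<^esub> lam_inv c)"
    using c by (simp add: transpose_kap lam_inv_natural)
  also have "\<dots> = \<epsilon>V (FOb V (FOb L c)) \<cdot>\<^bsub>Y\<^esub> FAr V (\<eta>V (FOb L c))"
    using c by (simp add: JK.triangle_L VW.triangle_L lam_inv_cancel del: B.L.FAr_Cmp')
  finally show ?thesis
    by (intro VW.transpose_inj[of _ _ "FOb V (FOb L c)"]) (use c in simp_all)
qed

text \<open>Transposing \<open>kap.mate y\<close> under \<open>L \<stileturn> R\<close> and then
  under \<open>V \<stileturn> W\<close> gives the counit of the composite adjunction of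
  \<open>L' J\<close> and \<open>K R'\<close>, precomposed with \<open>lam_inv\<close>. So
  \<open>kap.mate\<close> is the conjugate of \<open>lam_inv\<close>.\<close>

lemma transpose_kap_mate:
  assumes y: "y \<in> Ob Y"
  shows "\<epsilon>V y \<cdot>\<^bsub>Y\<^esub> FAr V (\<epsilon> (FOb W y) \<cdot>\<^bsub>X\<^esub> FAr L (kap.mate y))
    = \<epsilon>' y \<cdot>\<^bsub>Y\<^esub> (FAr L' (\<epsilon>J (FOb R' y)) \<cdot>\<^bsub>Y\<^esub> lam_inv (FOb K (FOb R' y)))"
  using y by (simp add: kap.transpose_mate VW.counit_natural transpose_kap del: V.FAr_Cmp')
    (simp add: VW.counit_natural transpose_kap y)

text \<open>Conjugation preserves inverses: the inverse \<open>g\<close> is the conjugate of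
  \<open>lam\<close>. Each composite is recognised as an identity by transposing it twice.\<close>

lemma kap_mate_invertible:
  assumes y: "y \<in> Ob Y"
  shows "\<exists>g. inverse_arrows C (kap.mate y) g"
proof -
  let ?rw = "FOb R (FOb W y)" and ?kr = "FOb K (FOb R' y)"
  \<comment> \<open>\<open>u\<close> is the counit of the composite adjunction of \<open>V L\<close>
    and \<open>R W\<close>, precomposed with \<open>lam\<close>. Its transposes under
    \<open>L' \<stileturn> R'\<close> and then \<open>J \<stileturn> K\<close> are \<open>v\<close>
    and \<open>g\<close>.\<close>
  define u where "u = \<epsilon>V y \<cdot>\<^bsub>Y\<^esub> (FAr V (\<epsilon> (FOb W y)) \<cdot>\<^bsub>Y\<^esub> lam ?rw)"
  have u [simp]: "u \<in> Ar Y" "Dom Y u = FOb L' (FOb J ?rw)" "Cod Y u = y"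
    using y by (simp_all add: u_def)
  define v where "v = FAr R' u \<cdot>\<^bsub>D\<^esub> \<eta>' (FOb J ?rw)"
  have v [simp]: "v \<in> Ar D" "Dom D v = FOb J ?rw" "Cod D v = FOb R' y"
    and tv: "\<epsilon>' y \<cdot>\<^bsub>Y\<^esub> FAr L' v = u"
    using y B.transpose_eq[of u "FOb J ?rw" y] by (simp_all add: v_def)
  define g where "g = FAr K v \<cdot>\<^bsub>C\<^esub> \<eta>J ?rw"
  have g [simp]: "g \<in> Ar C" "Dom C g = ?rw" "Cod C g = ?kr"
    and tg: "\<epsilon>J (FOb R' y) \<cdot>\<^bsub>D\<^esub> FAr J g = v"
    using y JK.transpose_eq[of v ?rw "FOb R' y"] by (simp_all add: g_def)
  have "\<epsilon>V y \<cdot>\<^bsub>Y\<^esub> FAr V (\<epsilon> (FOb W y) \<cdot>\<^bsub>X\<^esub> FAr L (kap.mate y \<cdot>\<^bsub>C\<^esub> g))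
      = (\<epsilon>V y \<cdot>\<^bsub>Y\<^esub> FAr V (\<epsilon> (FOb W y) \<cdot>\<^bsub>X\<^esub> FAr L (kap.mate y))) \<cdot>\<^bsub>Y\<^esub> FAr V (FAr L g)"
    using y by simp
  also have "\<dots> = (\<epsilon>' y \<cdot>\<^bsub>Y\<^esub> FAr L' (\<epsilon>J (FOb R' y) \<cdot>\<^bsub>D\<^esub> FAr J g)) \<cdot>\<^bsub>Y\<^esub> lam_inv ?rw"
    using y by (simp only: transpose_kap_mate) (simp add: lam_inv_natural)
  also have "\<dots> = \<epsilon>V y \<cdot>\<^bsub>Y\<^esub> FAr V (\<epsilon> (FOb W y) \<cdot>\<^bsub>X\<^esub> FAr L (Idn C ?rw))"
    using y by (simp only: tg tv) (simp add: u_def lam_inv_cancel)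
  finally have "\<epsilon> (FOb W y) \<cdot>\<^bsub>X\<^esub> FAr L (kap.mate y \<cdot>\<^bsub>C\<^esub> g) = \<epsilon> (FOb W y) \<cdot>\<^bsub>X\<^esub> FAr L (Idn C ?rw)"
    by (intro VW.transpose_inj[of _ _ y]) (use y in simp_all)
  then have 1: "kap.mate y \<cdot>\<^bsub>C\<^esub> g = Idn C ?rw"
    by (intro A.transpose_inj[of _ _ "FOb W y"]) (use y in simp_all)
  have "\<epsilon>' y \<cdot>\<^bsub>Y\<^esub> FAr L' (\<epsilon>J (FOb R' y) \<cdot>\<^bsub>D\<^esub> FAr J (g \<cdot>\<^bsub>C\<^esub> kap.mate y))
      = (\<epsilon>' y \<cdot>\<^bsub>Y\<^esub> FAr L' (\<epsilon>J (FOb R' y) \<cdot>\<^bsub>D\<^esub> FAr J g)) \<cdot>\<^bsub>Y\<^esub> FAr L' (FAr J (kap.mate y))"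
    using y by simp
  also have "\<dots> = (\<epsilon>V y \<cdot>\<^bsub>Y\<^esub> FAr V (\<epsilon> (FOb W y) \<cdot>\<^bsub>X\<^esub> FAr L (kap.mate y))) \<cdot>\<^bsub>Y\<^esub> lam ?kr"
    using y by (simp only: tg tv) (simp add: u_def lam_natural)
  also have "\<dots> = \<epsilon>' y \<cdot>\<^bsub>Y\<^esub> FAr L' (\<epsilon>J (FOb R' y) \<cdot>\<^bsub>D\<^esub> FAr J (Idn C ?kr))"
    using y by (simp only: transpose_kap_mate) (simp add: lam_inv_cancel)
  finally have "\<epsilon>J (FOb R' y) \<cdot>\<^bsub>D\<^esub> FAr J (g \<cdot>\<^bsub>C\<^esub> kap.mate y) = \<epsilon>J (FOb R' y) \<cdot>\<^bsub>D\<^esub> FAr J (Idn C ?kr)"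
    by (intro B.transpose_inj[of _ _ y]) (use y in simp_all)
  then have 2: "g \<cdot>\<^bsub>C\<^esub> kap.mate y = Idn C ?kr"
    by (intro JK.transpose_inj[of _ _ "FOb R' y"]) (use y in simp_all)
  show ?thesis
    by (rule exI[of _ g]) (use 1 2 y in \<open>simp add: inverse_arrows_def in_Hom_iff\<close>)
qed

end

text \<open>The two sides agree at every argument, not only at objects, so the whiskered formula can
  be replaced by \<open>kap\<close> as a function.\<close>

lemma (in doctrinal_adjunction) kap_eq:
  "kap = (W \<circ>\<^sub>f L' \<triangleright> \<epsilon>J \<bullet>\<^bsub>X\<^esub> W \<triangleright> inv_trans Y lam \<triangleleft> K \<bullet>\<^bsub>X\<^esub> \<eta>V \<triangleleft> (L \<circ>\<^sub>f K))"
  by (auto simp: kap_def lam_inv_def inv_trans_def)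

text \<open>Doctrinal adjunction in terms of adjunction records: an invertible left mate makes its
  conjugate formula the left mate of a right adjoint cell, with the given units and counits as
  2-cells.\<close>

lemma adjoint_object_doctrinal:
  assumes cell: "one_cell A B (J, V, lam)"
    and lam: "\<And>c. c \<in> Ob (lcat A) \<Longrightarrow> \<exists>g. inverse_arrows (rcat B) (lam c) g"
    and JK: "adjoint_pair (lcat A) (lcat B) J K \<eta>J \<epsilon>J"
    and VW: "adjoint_pair (rcat A) (rcat B) V W \<eta>V \<epsilon>V"
    and kap: "kap = (W \<circ>\<^sub>f ladj B \<triangleright> \<epsilon>J \<bullet>\<^bsub>rcat A\<^esub> W \<triangleright> inv_trans (rcat B) lam \<triangleleft> K \<bullet>\<^bsub>rcat A\<^esub>
      \<eta>V \<triangleleft> (ladj A \<circ>\<^sub>f K))"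
  shows "adjoint_object A B (J, V, lam) (K, W, kap) (\<eta>J, \<eta>V) (\<epsilon>J, \<epsilon>V)"
proof -
  have sq: "mate_square_adj A B J V lam"
    using cell by (simp add: one_cell_iff del: one_cell.simps)
  interpret D: doctrinal_adjunction "lcat A" "rcat A" "ladj A" "radj A" "unit A" "counit A"
    "lcat B" "rcat B" "ladj B" "radj B" "unit B" "counit B" J V lam K \<eta>J \<epsilon>J W \<eta>V \<epsilon>V
    using sq JK VW lam by (intro doctrinal_adjunction.intro doctrinal_adjunction_axioms.intro)
  have [simp]: "kap = D.kap"
    by (simp only: kap D.kap_eq)
  have cell': "one_cell B A (K, W, kap)"
    using D.kap.mate_square_axioms D.kap_mate_invertible
    by (simp add: one_cell_iff del: one_cell.simps)
  have adj: "adjunction A" "adjunction B"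
    using cell by simp_all
  show ?thesis
    using cell cell' one_cell_id[OF adj(1)] one_cell_id[OF adj(2)]
      one_cell_comp[OF cell cell'] one_cell_comp[OF cell' cell] JK VW
      D.JK.unit.nat_trans_axioms D.JK.counit.nat_trans_axioms
      D.VW.unit.nat_trans_axioms D.VW.counit.nat_trans_axioms
    by (auto simp: id_cell_def adjunction_iff D.counit_two_cell D.unit_two_cell
      simp del: one_cell.simps)
qed

section \<open>Parametric adjunctions\<close>

context parametric_adjunction
begin

sublocale C: category C by (rule categories)
sublocale P: category P by (rule categories)
sublocale D: category D by (rule categories)
sublocale J: cat_functor "C \<times>\<^sub>c P" D J by (rule left_functor)
sublocale K: cat_functor "op_cat P \<times>\<^sub>c D" C K by (rule right_functor)

lemma adjoint_pair_at: "p \<in> Ob P \<Longrightarrow> adjoint_pair C D (fix_snd P J p) (fix_fst P K p) (\<eta> p) (\<epsilon> p)"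
  using adjunction_at by (simp add: adjunction_iff param_adj_at_def)

lemma counit_typing [simp]:
  assumes "p \<in> Ob P" "d \<in> Ob D"
  shows "\<epsilon> p d \<in> Ar D" "Dom D (\<epsilon> p d) = FOb J (FOb K (p, d), p)" "Cod D (\<epsilon> p d) = d"
proof -
  interpret adjoint_pair C D "fix_snd P J p" "fix_fst P K p" "\<eta> p" "\<epsilon> p"
    by (rule adjoint_pair_at) fact
  show "\<epsilon> p d \<in> Ar D" "Dom D (\<epsilon> p d) = FOb J (FOb K (p, d), p)" "Cod D (\<epsilon> p d) = d"
    using assms by simp_all
qed

text \<open>\<open>K(f,g)\<close> factors as \<open>K(id,g)\<close> after \<open>K(f,id)\<close>,
  and \<open>right_on_arrows\<close> says that \<open>K(f,id)\<close> is the transpose of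
  \<open>?h\<close>. Naturality of the counit in \<open>g\<close> and \<open>transpose_eq\<close>
  for \<open>?h\<close> give the equation.\<close>

lemma counit_dinatural:
  assumes f: "f \<in> Ar P" and g: "g \<in> Ar D"
  shows "\<epsilon> (Dom P f) (Cod D g) \<cdot>\<^bsub>D\<^esub> FAr J (FAr K (f, g), Idn P (Dom P f))
    = g \<cdot>\<^bsub>D\<^esub> (\<epsilon> (Cod P f) (Dom D g) \<cdot>\<^bsub>D\<^esub> FAr J (Idn C (FOb K (Cod P f, Dom D g)), f))"
proof -
  let ?p = "Dom P f" and ?p' = "Cod P f" and ?d = "Dom D g"
  let ?h = "\<epsilon> ?p' ?d \<cdot>\<^bsub>D\<^esub> FAr J (Idn C (FOb K (?p', ?d)), f)"
  interpret adjoint_pair C D "fix_snd P J ?p" "fix_fst P K ?p" "\<eta> ?p" "\<epsilon> ?p"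
    using f by (intro adjoint_pair_at) simp
  have h: "?h \<in> Ar D" "Dom D ?h = FOb (fix_snd P J ?p) (FOb K (?p', ?d))" "Cod D ?h = ?d"
    using f g by simp_all
  let ?k = "FAr (fix_fst P K ?p) ?h \<cdot>\<^bsub>C\<^esub> \<eta> ?p (FOb K (?p', ?d))"
  \<comment> \<open>In \<open>right_on_arrows\<close> the two factors under \<open>K(p,-)\<close>
    are merged by functoriality.\<close>
  have "FAr K (f, Idn D ?d) = ?k"
    using right_on_arrows[of f ?p ?p' ?d] f g R.FAr_Cmp'[of "FAr J (Idn C (FOb K (?p', ?d)), f)" "\<epsilon> ?p' ?d"]
      unit.component_typing[of "FOb K (?p', ?d)"] R.FAr_typing[of "\<epsilon> ?p' ?d"]
      R.FAr_typing[of "FAr J (Idn C (FOb K (?p', ?d)), f)"]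
    by (simp add: in_Hom_iff arr_fst_def arr_snd_def)
  then have Kfg: "FAr K (f, g) = FAr (fix_fst P K ?p) g \<cdot>\<^bsub>C\<^esub> ?k"
    using bifunctor_Cmp[OF right_functor, of f "Idn P ?p" "Idn D ?d" g] f g by simp
  have k: "?k \<in> Ar C" "Dom C ?k = FOb K (?p', ?d)" "Cod C ?k = FOb (fix_fst P K ?p) ?d"
    using h f g R.FAr_typing[OF h(1)] unit.component_typing[of "FOb K (?p', ?d)"] by simp_all
  have "\<epsilon> ?p (Cod D g) \<cdot>\<^bsub>D\<^esub> FAr (fix_snd P J ?p) (FAr (fix_fst P K ?p) g \<cdot>\<^bsub>C\<^esub> ?k)
      = g \<cdot>\<^bsub>D\<^esub> (\<epsilon> ?p ?d \<cdot>\<^bsub>D\<^esub> FAr (fix_snd P J ?p) ?k)"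
    using k R.FAr_typing[OF g] L.FAr_Cmp'[of ?k "FAr (fix_fst P K ?p) g"]
      counit.naturality_assoc[of g "Cod D g" "FAr (fix_snd P J ?p) ?k"] g L.FAr_typing[OF k(1)]
    by (simp del: func_simps(7-10) L.FAr_Cmp')
  then show ?thesis
    using transpose_eq[OF h] f g by (simp add: Kfg)
qed

end

section \<open>The Hopf situation\<close>

text \<open>\<open>h\<close> and \<open>kap\<close> are parameters constrained by their defining
  formulas, so that \<open>hopf_trans\<close> and \<open>right_hopf_trans_at\<close> can be
  substituted for them.\<close>

locale hopf_parametric =
  S: mate_square "C \<times>\<^sub>c P" "X \<times>\<^sub>c Q" "L \<times>\<^sub>f Lt" "R \<times>\<^sub>f Rt" "\<eta> \<times>\<^sub>t \<eta>t" "\<epsilon> \<times>\<^sub>t \<epsilon>t" D Y L' R' \<eta>' \<epsilon>' J V lam +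
  A: adjoint_pair C X L R \<eta> \<epsilon> + A': adjoint_pair P Q Lt Rt \<eta>t \<epsilon>t +
  JK: parametric_adjunction C P D J K \<eta>J \<epsilon>J + VW: parametric_adjunction X Q Y V W \<eta>V \<epsilon>V
  for C :: "('c, 'cm) cat" and X :: "('x, 'xm) cat" and L R \<eta> \<epsilon>
    and P :: "('p, 'pm) cat" and Q :: "('q, 'qm) cat" and Lt Rt \<eta>t \<epsilon>t
    and D :: "('d, 'dm) cat" and Y :: "('y, 'ym) cat" and L' R' \<eta>' \<epsilon>'
    and J V lam K \<eta>J \<epsilon>J W \<eta>V \<epsilon>V +
  fixes h :: "'c \<times> 'q \<Rightarrow> 'ym" and kap :: "'q \<Rightarrow> 'd \<Rightarrow> 'xm"
  assumes mate_invertible: "z \<in> Ob (X \<times>\<^sub>c Q) \<Longrightarrow> \<exists>g. inverse_arrows D (S.mate z) g"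
    and h_eq: "h (c, q) = FAr V (Idn X (FOb L c), \<epsilon>t q) \<cdot>\<^bsub>Y\<^esub> lam (c, FOb Rt q)"
    and h_invertible: "invertible_trans (C \<times>\<^sub>c Q) Y (L' \<circ>\<^sub>f J \<circ>\<^sub>f (id_func \<times>\<^sub>f Rt))
      (V \<circ>\<^sub>f (L \<times>\<^sub>f id_func)) h"
    and kap_eq: "kap q = (fix_fst Q W q \<circ>\<^sub>f L' \<triangleright> \<epsilon>J (FOb Rt q) \<bullet>\<^bsub>X\<^esub>
      fix_fst Q W q \<triangleright> inv_trans Y (\<lambda>c. h (c, q)) \<triangleleft> fix_fst P K (FOb Rt q) \<bullet>\<^bsub>X\<^esub>
      \<eta>V q \<triangleleft> (L \<circ>\<^sub>f fix_fst P K (FOb Rt q)))"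
begin

lemma h_nat_trans: "nat_trans (C \<times>\<^sub>c Q) Y (L' \<circ>\<^sub>f J \<circ>\<^sub>f (id_func \<times>\<^sub>f Rt)) (V \<circ>\<^sub>f (L \<times>\<^sub>f id_func)) h"
  by (rule invertible_transD) (rule h_invertible)

sublocale h: nat_trans "C \<times>\<^sub>c Q" Y "L' \<circ>\<^sub>f J \<circ>\<^sub>f (id_func \<times>\<^sub>f Rt)" "V \<circ>\<^sub>f (L \<times>\<^sub>f id_func)" h
  by (rule h_nat_trans)

lemma cat_functor_J_Rt: "cat_functor (C \<times>\<^sub>c Q) D (J \<circ>\<^sub>f (id_func \<times>\<^sub>f Rt))"
  by (rule cat_functor_comp[OF cat_functor_prod[OF cat_functor_id A'.R.cat_functor_axioms]
    JK.left_functor]) (rule JK.categories(1))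

lemma h_mate_square:
  "mate_square (C \<times>\<^sub>c Q) (X \<times>\<^sub>c Q) (L \<times>\<^sub>f id_func) (R \<times>\<^sub>f id_func) (\<eta> \<times>\<^sub>t Idn Q) (\<epsilon> \<times>\<^sub>t Idn Q)
    D Y L' R' \<eta>' \<epsilon>' (J \<circ>\<^sub>f (id_func \<times>\<^sub>f Rt)) V h"
  by (intro mate_square.intro adjoint_pair_prod adjoint_pair_id A.adjoint_pair_axioms
    S.B.adjoint_pair_axioms cat_functor_J_Rt h_nat_trans VW.left_functor VW.categories(2))

text \<open>Bifunctoriality of \<open>V\<close> merges the two separate counits into the counit of
  the product adjunction. The left side is the right mate of \<open>h\<close> at
  \<open>(x, q)\<close>, both over the product and for fixed \<open>q\<close>.\<close>

lemma h_mate: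
  assumes "x \<in> Ob X" "q \<in> Ob Q"
  shows "FAr R' (FAr V (\<epsilon> x, Idn Q q)) \<cdot>\<^bsub>D\<^esub> (FAr R' (h (FOb R x, q)) \<cdot>\<^bsub>D\<^esub> \<eta>' (FOb J (FOb R x, FOb Rt q)))
    = S.mate (x, q)"
proof -
  have "FAr V (\<epsilon> x, Idn Q q) \<cdot>\<^bsub>Y\<^esub> h (FOb R x, q)
      = (FAr V (\<epsilon> x, Idn Q q) \<cdot>\<^bsub>Y\<^esub> FAr V (Idn X (FOb L (FOb R x)), \<epsilon>t q)) \<cdot>\<^bsub>Y\<^esub> lam (FOb R x, FOb Rt q)"
    using assms by (simp add: h_eq)
  also have "\<dots> = FAr V (\<epsilon> x, \<epsilon>t q) \<cdot>\<^bsub>Y\<^esub> lam (FOb R x, FOb Rt q)"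
    using assms by (simp add: bifunctor_Cmp[OF VW.left_functor])
  finally have "FAr R' (FAr V (\<epsilon> x, Idn Q q)) \<cdot>\<^bsub>D\<^esub> FAr R' (h (FOb R x, q))
      = FAr R' (FAr V (\<epsilon> x, \<epsilon>t q)) \<cdot>\<^bsub>D\<^esub> FAr R' (lam (FOb R x, FOb Rt q))"
    using assms by (simp flip: S.B.R.FAr_Cmp')
  then have "(FAr R' (FAr V (\<epsilon> x, Idn Q q)) \<cdot>\<^bsub>D\<^esub> FAr R' (h (FOb R x, q))) \<cdot>\<^bsub>D\<^esub> \<eta>' (FOb J (FOb R x, FOb Rt q))
      = (FAr R' (FAr V (\<epsilon> x, \<epsilon>t q)) \<cdot>\<^bsub>D\<^esub> FAr R' (lam (FOb R x, FOb Rt q))) \<cdot>\<^bsub>D\<^esub> \<eta>' (FOb J (FOb R x, FOb Rt q))"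
    by simp
  then show ?thesis
    using assms by (simp add: S.mate_def)
qed

lemma h_mate_square_at:
  assumes q: "q \<in> Ob Q"
  shows "mate_square C X L R \<eta> \<epsilon> D Y L' R' \<eta>' \<epsilon>' (fix_snd P J (FOb Rt q)) (fix_snd Q V q) (\<lambda>c. h (c, q))"
proof -
  \<comment> \<open>The first equality uses that \<open>Rt\<close> preserves the identity of
    \<open>q\<close>.\<close>
  have eq: "fix_snd Q (L' \<circ>\<^sub>f J \<circ>\<^sub>f (id_func \<times>\<^sub>f Rt)) q = L' \<circ>\<^sub>f fix_snd P J (FOb Rt q)"
    "fix_snd Q (V \<circ>\<^sub>f (L \<times>\<^sub>f id_func)) q = fix_snd Q V q \<circ>\<^sub>f L"
    using q by (simp_all add: fix_snd_def comp_func_def)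
  show ?thesis
    using nat_trans_fix_snd[OF JK.categories(1) VW.categories(2) h_nat_trans q] q
    by (intro mate_square.intro A.adjoint_pair_axioms S.B.adjoint_pair_axioms
      cat_functor_fix_snd JK.categories(1) JK.categories(2) JK.left_functor
      VW.categories(1) VW.categories(2) VW.left_functor) (simp_all add: eq)
qed

text \<open>The left Hopf condition supplies the invertibility of the left mate
  \<open>h(-,q)\<close> at each parameter \<open>q\<close>.\<close>

lemma doctrinal_at:
  assumes q: "q \<in> Ob Q"
  shows "doctrinal_adjunction C X L R \<eta> \<epsilon> D Y L' R' \<eta>' \<epsilon>'
    (fix_snd P J (FOb Rt q)) (fix_snd Q V q) (\<lambda>c. h (c, q))
    (fix_fst P K (FOb Rt q)) (\<eta>J (FOb Rt q)) (\<epsilon>J (FOb Rt q)) (fix_fst Q W q) (\<eta>V q) (\<epsilon>V q)"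
  using q invertible_transD(2)[OF h_invertible]
  by (intro doctrinal_adjunction.intro doctrinal_adjunction_axioms.intro h_mate_square_at
    JK.adjoint_pair_at VW.adjoint_pair_at) auto

lemma kap_facts:
  assumes q: "q \<in> Ob Q" and d: "d \<in> Ob D"
  shows kap_typing: "kap q d \<in> Ar X" "Dom X (kap q d) = FOb L (FOb K (FOb Rt q, d))"
      "Cod X (kap q d) = FOb W (q, FOb L' d)"
    and transpose_kap: "\<epsilon>V q (FOb L' d) \<cdot>\<^bsub>Y\<^esub> FAr V (kap q d, Idn Q q)
      = FAr L' (\<epsilon>J (FOb Rt q) d) \<cdot>\<^bsub>Y\<^esub> inv_arrow Y (h (FOb K (FOb Rt q, d), q))"
proof -
  interpret D: doctrinal_adjunction C X L R \<eta> \<epsilon> D Y L' R' \<eta>' \<epsilon>'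
    "fix_snd P J (FOb Rt q)" "fix_snd Q V q" "\<lambda>c. h (c, q)"
    "fix_fst P K (FOb Rt q)" "\<eta>J (FOb Rt q)" "\<epsilon>J (FOb Rt q)" "fix_fst Q W q" "\<eta>V q" "\<epsilon>V q"
    by (rule doctrinal_at) fact
  have [simp]: "kap q = D.kap"
    by (simp only: kap_eq D.kap_eq)
  show "kap q d \<in> Ar X" "Dom X (kap q d) = FOb L (FOb K (FOb Rt q, d))"
      "Cod X (kap q d) = FOb W (q, FOb L' d)"
    using d D.kap_typing[OF d] by simp_all
  show "\<epsilon>V q (FOb L' d) \<cdot>\<^bsub>Y\<^esub> FAr V (kap q d, Idn Q q)
      = FAr L' (\<epsilon>J (FOb Rt q) d) \<cdot>\<^bsub>Y\<^esub> inv_arrow Y (h (FOb K (FOb Rt q, d), q))"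
    using D.transpose_kap[OF d] by (simp add: D.lam_inv_def)
qed

lemmas [simp] = kap_typing

text \<open>The \<open>lam_inv\<close> of \<open>doctrinal_at\<close> has \<open>q\<close> fixed;
  this version is natural in both arguments, as variation of \<open>q\<close> requires.\<close>

definition h_inv :: "'c \<times> 'q \<Rightarrow> 'ym"
  where "h_inv z = inv_arrow Y (h z)"

sublocale h_inv: nat_trans "C \<times>\<^sub>c Q" Y "V \<circ>\<^sub>f (L \<times>\<^sub>f id_func)" "L' \<circ>\<^sub>f J \<circ>\<^sub>f (id_func \<times>\<^sub>f Rt)" h_inv
  using nat_trans_inv_trans[OF h_invertible] by (simp add: inv_trans_def h_inv_def[abs_def])

text \<open>Naturality in both variables at once, compared after transposition under the adjunction
  at the source of \<open>f\<close>. Changing the parameter uses dinaturality of both families of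
  counits together with naturality of \<open>h_inv\<close>.\<close>

lemma kap_natural:
  assumes f: "f \<in> Ar Q" and g: "g \<in> Ar D"
  shows "kap (Dom Q f) (Cod D g) \<cdot>\<^bsub>X\<^esub> FAr L (FAr K (FAr Rt f, g))
    = FAr W (f, FAr L' g) \<cdot>\<^bsub>X\<^esub> kap (Cod Q f) (Dom D g)"
proof -
  let ?q = "Dom Q f" and ?q' = "Cod Q f" and ?d = "Dom D g" and ?d' = "Cod D g"
  let ?p = "FOb Rt ?q" and ?p' = "FOb Rt ?q'"
  let ?k = "FOb K (?p', ?d)" and ?Kfg = "FAr K (FAr Rt f, g)" and ?Wfg = "FAr W (f, FAr L' g)"
  have Kfg [simp]: "?Kfg \<in> Ar C" "Dom C ?Kfg = ?k" "Cod C ?Kfg = FOb K (?p, ?d')"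
    using f g by simp_all
  have Wfg [simp]: "?Wfg \<in> Ar X" "Dom X ?Wfg = FOb W (?q', FOb L' ?d)" "Cod X ?Wfg = FOb W (?q, FOb L' ?d')"
    using f g by simp_all
  have V_Cmp: "FAr V (a', b') \<cdot>\<^bsub>Y\<^esub> FAr V (a, b) = FAr V (a' \<cdot>\<^bsub>X\<^esub> a, b' \<cdot>\<^bsub>Q\<^esub> b)"
    if "a \<in> Ar X" "a' \<in> Ar X" "b \<in> Ar Q" "b' \<in> Ar Q" "Cod X a = Dom X a'" "Cod Q b = Dom Q b'"
    for a a' b b'
    using that by (intro bifunctor_Cmp[OF VW.left_functor])
  have typing [simp]:
    "h_inv (FOb K (?p, ?d'), ?q) \<in> Ar Y" "h_inv (?k, ?q) \<in> Ar Y" "h_inv (?k, ?q') \<in> Ar Y"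
    "Dom Y (h_inv (FOb K (?p, ?d'), ?q)) = FOb V (FOb L (FOb K (?p, ?d')), ?q)"
    "Dom Y (h_inv (?k, ?q)) = FOb V (FOb L ?k, ?q)"
    "Dom Y (h_inv (?k, ?q')) = FOb V (FOb L ?k, ?q')"
    "Cod Y (h_inv (FOb K (?p, ?d'), ?q)) = FOb L' (FOb J (FOb K (?p, ?d'), ?p))"
    "Cod Y (h_inv (?k, ?q)) = FOb L' (FOb J (?k, ?p))"
    "Cod Y (h_inv (?k, ?q')) = FOb L' (FOb J (?k, ?p'))"
    using f g by simp_all
  have "\<epsilon>V ?q (FOb L' ?d') \<cdot>\<^bsub>Y\<^esub> FAr V (kap ?q ?d' \<cdot>\<^bsub>X\<^esub> FAr L ?Kfg, Idn Q ?q)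
      = (\<epsilon>V ?q (FOb L' ?d') \<cdot>\<^bsub>Y\<^esub> FAr V (kap ?q ?d', Idn Q ?q)) \<cdot>\<^bsub>Y\<^esub> FAr V (FAr L ?Kfg, Idn Q ?q)"
    using f g by (simp add: V_Cmp)
  also have "\<dots> = FAr L' (\<epsilon>J ?p ?d') \<cdot>\<^bsub>Y\<^esub> (h_inv (FOb K (?p, ?d'), ?q) \<cdot>\<^bsub>Y\<^esub> FAr V (FAr L ?Kfg, Idn Q ?q))"
    using f g by (simp add: transpose_kap flip: h_inv_def)
  also have "\<dots> = FAr L' (\<epsilon>J ?p ?d' \<cdot>\<^bsub>D\<^esub> FAr J (?Kfg, Idn P ?p)) \<cdot>\<^bsub>Y\<^esub> h_inv (?k, ?q)"
    using f g h_inv.naturality'[of "(?Kfg, Idn Q ?q)" "(FOb K (?p, ?d'), ?q)"] by simp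
  \<comment> \<open>Dinaturality of \<open>\<epsilon>J\<close> along \<open>Rt f\<close> passes from
    parameter \<open>?p\<close> to \<open>?p'\<close>.\<close>
  also have "\<dots> = FAr L' (g \<cdot>\<^bsub>D\<^esub> (\<epsilon>J ?p' ?d \<cdot>\<^bsub>D\<^esub> FAr J (Idn C ?k, FAr Rt f))) \<cdot>\<^bsub>Y\<^esub> h_inv (?k, ?q)"
    using f g JK.counit_dinatural[of "FAr Rt f" g] by simp
  \<comment> \<open>Naturality of \<open>h_inv\<close> in its second argument turns
    \<open>Rt f\<close> inside \<open>J\<close> into \<open>f\<close> inside
    \<open>V\<close>.\<close>
  also have "\<dots> = FAr L' g \<cdot>\<^bsub>Y\<^esub> (FAr L' (\<epsilon>J ?p' ?d) \<cdot>\<^bsub>Y\<^esub> (h_inv (?k, ?q') \<cdot>\<^bsub>Y\<^esub> FAr V (Idn X (FOb L ?k), f)))"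
    using f g h_inv.naturality'[of "(Idn C ?k, f)" "(?k, ?q')"] by simp
  also have "\<dots> = FAr L' g \<cdot>\<^bsub>Y\<^esub> ((\<epsilon>V ?q' (FOb L' ?d) \<cdot>\<^bsub>Y\<^esub> FAr V (kap ?q' ?d, Idn Q ?q'))
      \<cdot>\<^bsub>Y\<^esub> FAr V (Idn X (FOb L ?k), f))"
    using f g by (simp add: transpose_kap flip: h_inv_def)
  \<comment> \<open>Interchange of the two arguments of \<open>V\<close> brings \<open>f\<close>
    next to \<open>\<epsilon>V\<close>, ready for dinaturality.\<close>
  also have "\<dots> = FAr L' g \<cdot>\<^bsub>Y\<^esub> (\<epsilon>V ?q' (FOb L' ?d) \<cdot>\<^bsub>Y\<^esub> (FAr V (Idn X (FOb W (?q', FOb L' ?d)), f)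
      \<cdot>\<^bsub>Y\<^esub> FAr V (kap ?q' ?d, Idn Q ?q)))"
    using f g by (simp add: V_Cmp)
  also have "\<dots> = (\<epsilon>V ?q (FOb L' ?d') \<cdot>\<^bsub>Y\<^esub> FAr V (?Wfg, Idn Q ?q)) \<cdot>\<^bsub>Y\<^esub> FAr V (kap ?q' ?d, Idn Q ?q)"
    using f g VW.counit_dinatural[of f "FAr L' g"] by simp
  also have "\<dots> = \<epsilon>V ?q (FOb L' ?d') \<cdot>\<^bsub>Y\<^esub> FAr V (?Wfg \<cdot>\<^bsub>X\<^esub> kap ?q' ?d, Idn Q ?q)"
    using f g by (simp add: V_Cmp)
  finally show ?thesis
    by (intro adjoint_pair.transpose_inj[OF VW.adjoint_pair_at, of ?q _ _ "FOb L' ?d'"])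
      (use f g in simp_all)
qed

text \<open>An arrow of \<open>op_cat Q\<close> is an arrow of \<open>Q\<close> with its ends
  exchanged, so \<open>kap_natural\<close> is exactly the required naturality square.\<close>

lemma kap_mate_square:
  "mate_square (op_cat Q \<times>\<^sub>c D) (op_cat Q \<times>\<^sub>c Y) (id_func \<times>\<^sub>f L') (id_func \<times>\<^sub>f R')
    (Idn (op_cat Q) \<times>\<^sub>t \<eta>') (Idn (op_cat Q) \<times>\<^sub>t \<epsilon>') C X L R \<eta> \<epsilon>
    (K \<circ>\<^sub>f (Rt \<times>\<^sub>f id_func)) W (\<lambda>(q, d). kap q d)"
proof -
  have K: "cat_functor (op_cat Q \<times>\<^sub>c D) C (K \<circ>\<^sub>f (Rt \<times>\<^sub>f id_func))"
    by (rule cat_functor_comp[OF cat_functor_prod[OF cat_functor_op[OF A'.R.cat_functor_axioms]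
      cat_functor_id[OF JK.categories(3)]] JK.right_functor])
  have W: "cat_functor (op_cat Q \<times>\<^sub>c D) X (W \<circ>\<^sub>f (id_func \<times>\<^sub>f L'))"
    by (rule cat_functor_comp[OF cat_functor_prod[OF cat_functor_id[OF
      category_op[OF VW.categories(2)]] S.B.L.cat_functor_axioms] VW.right_functor])
  show ?thesis
    by (intro mate_square.intro adjoint_pair_prod adjoint_pair_id category_op VW.categories
        S.B.adjoint_pair_axioms A.adjoint_pair_axioms K VW.right_functor nat_transI
        cat_functor_comp[OF K A.L.cat_functor_axioms] W)
      (auto simp: kap_natural)
qed

text \<open>The displayed composite is the right mate of the cell over
  \<open>op_cat Q \<times>\<^sub>c D\<close> at \<open>(q, y)\<close>, and it coincides with the
  right mate in the doctrinal adjunction at \<open>q\<close>.\<close>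

lemma kap_mate_invertible:
  assumes q: "q \<in> Ob Q" and y: "y \<in> Ob Y"
  shows "\<exists>g. inverse_arrows C (FAr R (FAr W (Idn Q q, \<epsilon>' y)) \<cdot>\<^bsub>C\<^esub>
    (FAr R (kap q (FOb R' y)) \<cdot>\<^bsub>C\<^esub> \<eta> (FOb K (FOb Rt q, FOb R' y)))) g"
proof -
  interpret D: doctrinal_adjunction C X L R \<eta> \<epsilon> D Y L' R' \<eta>' \<epsilon>'
    "fix_snd P J (FOb Rt q)" "fix_snd Q V q" "\<lambda>c. h (c, q)"
    "fix_fst P K (FOb Rt q)" "\<eta>J (FOb Rt q)" "\<epsilon>J (FOb Rt q)" "fix_fst Q W q" "\<eta>V q" "\<epsilon>V q"
    by (rule doctrinal_at) fact
  have "kap q = D.kap"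
    by (simp only: kap_eq D.kap_eq)
  then show ?thesis
    using D.kap_mate_invertible[OF y] by (simp add: D.kap.mate_def)
qed

end

theorem theorem3p2p5:
  fixes A :: "('c, 'cm, 'x, 'xm) adj"
    and A' :: "('p, 'pm, 'q, 'qm) adj"
    and B :: "('d, 'dm, 'y, 'ym) adj"
    and J :: "('c \<times> 'p, 'cm \<times> 'pm, 'd, 'dm) func"
    and V :: "('x \<times> 'q, 'xm \<times> 'qm, 'y, 'ym) func"
    and lam :: "'c \<times> 'p \<Rightarrow> 'ym"
    and K :: "('p \<times> 'd, 'pm \<times> 'dm, 'c, 'cm) func"
    and W :: "('q \<times> 'y, 'qm \<times> 'ym, 'x, 'xm) func"
    and \<eta>JK :: "'p \<Rightarrow> 'c \<Rightarrow> 'cm" and \<epsilon>JK :: "'p \<Rightarrow> 'd \<Rightarrow> 'dm"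
    and \<eta>VW :: "'q \<Rightarrow> 'x \<Rightarrow> 'xm" and \<epsilon>VW :: "'q \<Rightarrow> 'y \<Rightarrow> 'ym"
  assumes "adjunction A" and "adjunction A'" and "adjunction B"
    and "left_hopf A A' B (J, V, lam)"
    and "parametric_adjunction (lcat A) (lcat A') (lcat B) J K \<eta>JK \<epsilon>JK"
    and "parametric_adjunction (rcat A) (rcat A') (rcat B) V W \<eta>VW \<epsilon>VW"
  shows "one_cell (A \<times>\<^sub>a id_adj (rcat A')) B
      (J \<circ>\<^sub>f (id_func \<times>\<^sub>f radj A'), V, hopf_trans A A' B V lam) \<and>
    one_cell (id_adj (op_cat (rcat A')) \<times>\<^sub>a B) A
      (K \<circ>\<^sub>f (op_func (radj A') \<times>\<^sub>f id_func), W,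
       right_hopf_trans A A' B V lam K W \<epsilon>JK \<eta>VW) \<and>
    (\<forall>Q\<in>Ob (rcat A'). adjoint_object A B
      (fix_snd (lcat A') J (FOb (radj A') Q),
       fix_snd (rcat A') V Q,
       hopf_trans_at A A' B V lam Q)
      (fix_fst (lcat A') K (FOb (radj A') Q),
       fix_fst (rcat A') W Q,
       right_hopf_trans_at A A' B V lam K W \<epsilon>JK \<eta>VW Q)
      (\<eta>JK (FOb (radj A') Q), \<eta>VW Q)
      (\<epsilon>JK (FOb (radj A') Q), \<epsilon>VW Q))"
proof -
  let ?h = "hopf_trans A A' B V lam"
  let ?kap = "right_hopf_trans_at A A' B V lam K W \<epsilon>JK \<eta>VW"
  have cell: "one_cell (A \<times>\<^sub>a A') B (J, V, lam)"
    and h: "invertible_trans (lcat A \<times>\<^sub>c rcat A') (rcat B)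
      (ladj B \<circ>\<^sub>f J \<circ>\<^sub>f (id_func \<times>\<^sub>f radj A')) (V \<circ>\<^sub>f (ladj A \<times>\<^sub>f id_func)) ?h"
    using assms(4) by (simp_all del: one_cell.simps)
  have pairs: "adjoint_pair (lcat A) (rcat A) (ladj A) (radj A) (unit A) (counit A)"
    "adjoint_pair (lcat A') (rcat A') (ladj A') (radj A') (unit A') (counit A')"
    using assms(1,2) by (simp_all add: adjunction_iff)
  interpret hopf_parametric "lcat A" "rcat A" "ladj A" "radj A" "unit A" "counit A"
    "lcat A'" "rcat A'" "ladj A'" "radj A'" "unit A'" "counit A'"
    "lcat B" "rcat B" "ladj B" "radj B" "unit B" "counit B"
    J V lam K \<eta>JK \<epsilon>JK W \<eta>VW \<epsilon>VW ?h ?kap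
  proof (intro hopf_parametric.intro hopf_parametric_axioms.intro pairs assms(5,6) h)
    show "mate_square (lcat A \<times>\<^sub>c lcat A') (rcat A \<times>\<^sub>c rcat A') (ladj A \<times>\<^sub>f ladj A') (radj A \<times>\<^sub>f radj A')
      (unit A \<times>\<^sub>t unit A') (counit A \<times>\<^sub>t counit A')
      (lcat B) (rcat B) (ladj B) (radj B) (unit B) (counit B) J V lam"
      using cell by (simp add: one_cell_iff del: one_cell.simps)
  next
    fix z assume "z \<in> Ob (rcat A \<times>\<^sub>c rcat A')"
    then show "\<exists>g. inverse_arrows (lcat B) (mate_square.mate (radj A \<times>\<^sub>f radj A')
        (counit A \<times>\<^sub>t counit A') (lcat B) (radj B) (unit B) J V lam z) g"
      using cell by (auto simp: one_cell_iff simp del: one_cell.simps)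
  next
    fix c q
    show "?h (c, q) = FAr V (Idn (rcat A) (FOb (ladj A) c), counit A' q)
        \<cdot>\<^bsub>rcat B\<^esub> lam (c, FOb (radj A') q)"
      by (simp add: hopf_trans_def)
  next
    fix q
    show "?kap q = (fix_fst (rcat A') W q \<circ>\<^sub>f ladj B \<triangleright> \<epsilon>JK (FOb (radj A') q) \<bullet>\<^bsub>rcat A\<^esub>
        fix_fst (rcat A') W q \<triangleright> inv_trans (rcat B) (\<lambda>c. ?h (c, q)) \<triangleleft> fix_fst (lcat A') K (FOb (radj A') q) \<bullet>\<^bsub>rcat A\<^esub>
        \<eta>VW q \<triangleleft> (ladj A \<circ>\<^sub>f fix_fst (lcat A') K (FOb (radj A') q)))"
      by (simp add: right_hopf_trans_at_def hopf_trans_at_def Let_def)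
  qed
  \<comment> \<open>By \<open>h_mate\<close>, the right mate here equals that of \<open>lam\<close>
    at the same object, which is invertible because \<open>(J, V, lam)\<close> is a 1-cell.\<close>
  have "one_cell (A \<times>\<^sub>a id_adj (rcat A')) B (J \<circ>\<^sub>f (id_func \<times>\<^sub>f radj A'), V, ?h)"
    using h_mate_square mate_invertible
    by (auto simp: one_cell_iff mate_square.mate_def[OF h_mate_square] h_mate simp del: one_cell.simps)
  moreover have "one_cell (id_adj (op_cat (rcat A')) \<times>\<^sub>a B) A
      (K \<circ>\<^sub>f (op_func (radj A') \<times>\<^sub>f id_func), W, right_hopf_trans A A' B V lam K W \<epsilon>JK \<eta>VW)"
    using kap_mate_square kap_mate_invertible
    by (auto simp: one_cell_iff right_hopf_trans_def mate_square.mate_def[OF kap_mate_square, simplified op_cat_simps]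
      simp del: one_cell.simps)
  moreover have "adjoint_object A B
      (fix_snd (lcat A') J (FOb (radj A') q), fix_snd (rcat A') V q, hopf_trans_at A A' B V lam q)
      (fix_fst (lcat A') K (FOb (radj A') q), fix_fst (rcat A') W q, ?kap q)
      (\<eta>JK (FOb (radj A') q), \<eta>VW q) (\<epsilon>JK (FOb (radj A') q), \<epsilon>VW q)"
    if q: "q \<in> Ob (rcat A')" for q
  proof (rule adjoint_object_doctrinal)
    interpret M: mate_square "lcat A" "rcat A" "ladj A" "radj A" "unit A" "counit A"
      "lcat B" "rcat B" "ladj B" "radj B" "unit B" "counit B"
      "fix_snd (lcat A') J (FOb (radj A') q)" "fix_snd (rcat A') V q" "hopf_trans_at A A' B V lam q"
      using h_mate_square_at[OF q] by (simp add: hopf_trans_at_def)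
    \<comment> \<open>For fixed \<open>q\<close> the mate at \<open>x\<close> is again the right
      mate of \<open>lam\<close> at \<open>(x, q)\<close>.\<close>
    have "\<exists>g. inverse_arrows (lcat B) (M.mate x) g" if "x \<in> Ob (rcat A)" for x
      using that q h_mate[OF that q] mate_invertible[of "(x, q)"]
      by (simp add: M.mate_def) (simp add: hopf_trans_at_def)
    then show "one_cell A B (fix_snd (lcat A') J (FOb (radj A') q), fix_snd (rcat A') V q,
        hopf_trans_at A A' B V lam q)"
      using M.mate_square_axioms by (simp add: one_cell_iff del: one_cell.simps)
  next
    fix c assume "c \<in> Ob (lcat A)"
    then show "\<exists>g. inverse_arrows (rcat B) (hopf_trans_at A A' B V lam q c) g"
      using invertible_transD(2)[OF h, of "(c, q)"] q by (simp add: hopf_trans_at_def)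
  next
    show "adjoint_pair (lcat A) (lcat B) (fix_snd (lcat A') J (FOb (radj A') q))
        (fix_fst (lcat A') K (FOb (radj A') q)) (\<eta>JK (FOb (radj A') q)) (\<epsilon>JK (FOb (radj A') q))"
      using q by (intro JK.adjoint_pair_at) simp
    show "adjoint_pair (rcat A) (rcat B) (fix_snd (rcat A') V q) (fix_fst (rcat A') W q)
        (\<eta>VW q) (\<epsilon>VW q)"
      using q by (rule VW.adjoint_pair_at)
  qed (simp add: right_hopf_trans_at_def Let_def)
  ultimately show ?thesis
    by blast
qed

end
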